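(* Fix $\boldsymbol\lambda=(\lambda_1,\lambda_2)\in(0,\infty)^2$. There exists at most one function $\psi:\mathbb R\to\mathbb R$ that is Lipschitz, bounded from below, and satisfies $\psi=\mathcal T^{\boldsymbol\lambda}\psi$ on $\mathbb R$.
   Context: Let $(\Omega,\mathcal F,\mathbb P,\mathbb F)$ be a filtered probability space satisfying the usual conditions and supporting a standard one-dimensional Brownian motion $W$. For $x\in\mathbb R$, $X=X^x$ solves $dX_t=b(X_t)dt+\sigma(X_t)dW_t$, $X_0=x$; $\mathbb E^x$ is the associated expectation. Standing assumptions: there is $L>0$ with $|b(x)-b(y)|+|\sigma(x)-\sigma(y)|\le L|x-y|$, and $\sigma_0>0$ with $|\sigma|\ge\sigma_0$; $f:\mathbb R\to[0,\infty)$, $f(0)=0$, $f$ is $L_f$-Lipschitz; $l:\mathbb R\to\mathbb R$ satisfies: there is $K>0$ with $\inf l=l(0)=K$ and $l(x)+l(y)\ge l(x+y)+K$, $l(\xi)\to\infty$ as $|\xi|\to\infty$, $l$ is $L_l$-Lipschitz; with $G=L+\frac12L^2$, $0<r-G<L_f/L_l$. Let $\Phi_x=\mathcal N(-x,1)$. For $\lambda>0$ and $\phi$ bounded below, $\mathcal M^\lambda\phi(x)=\inf\{\int(\phi(x+\xi)+l(\xi))\mu(d\xi)+\lambda D_{KL}(\mu\|\Phi_x)\}$ over probability measures $\mu\ll\Phi_x$. With $\mathcal R(y)=y-y\log y$, $\mathcal R(0)=0$, define $T^\lambda\phi(x)=\inf_\pi\mathbb E^x\big[\int_0^\infty e^{-\int_0^t(r+\pi_s)ds}(f(X_t)-\lambda\mathcal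 R(\pi_t)+\pi_t\phi(X_t))dt\big]$ over nonnegative progressively measurable $\pi$, and $\mathcal T^{\boldsymbol\lambda}\phi=T^{\lambda_1}[\mathcal M^{\lambda_2}\phi]$. *)

theory Defs
  imports "HOL-Probability.Probability"
begin

text \<open>Extended-real integral of a real function whose negative part is integrable:
  integral of positive part minus integral of negative part (values in ereal).\<close>
definition ext_integral :: "'b measure \<Rightarrow> ('b \<Rightarrow> real) \<Rightarrow> ereal" where
  "ext_integral N h =
     enn2ereal (\<integral>\<^sup>+ z. ennreal (h z) \<partial>N) - enn2ereal (\<integral>\<^sup>+ z. ennreal (- h z) \<partial>N)"

definition usual_filtration :: "'a measure \<Rightarrow> (real \<Rightarrow> 'a measure) \<Rightarrow> bool" where
  "usual_filtration M F \<longleftrightarrow>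
     (\<forall>t\<ge>0. subalgebra M (F t)) \<and>
     (\<forall>s t. 0 \<le> s \<longrightarrow> s \<le> t \<longrightarrow> sets (F s) \<subseteq> sets (F t)) \<and>
     (\<forall>t\<ge>0. (\<Inter>s\<in>{t<..}. sets (F s)) \<subseteq> sets (F t)) \<and>
     (\<forall>N\<in>null_sets M. \<forall>A. A \<subseteq> N \<longrightarrow> A \<in> sets (F 0))"

definition adapted :: "'a measure \<Rightarrow> (real \<Rightarrow> 'a measure) \<Rightarrow> (real \<Rightarrow> 'a \<Rightarrow> real) \<Rightarrow> bool" where
  "adapted M F Y \<longleftrightarrow> (\<forall>t\<ge>0. Y t \<in> borel_measurable (F t))"

definition martingale :: "'a measure \<Rightarrow> (real \<Rightarrow> 'a measure) \<Rightarrow> (real \<Rightarrow> 'a \<Rightarrow> real) \<Rightarrow> bool" where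
  "martingale M F Y \<longleftrightarrow> adapted M F Y \<and> (\<forall>t\<ge>0. integrable M (Y t)) \<and>
     (\<forall>s t. 0 \<le> s \<longrightarrow> s \<le> t \<longrightarrow> (AE \<omega> in M. real_cond_exp M (F s) (Y t) \<omega> = Y s \<omega>))"

definition brownian_motion :: "'a measure \<Rightarrow> (real \<Rightarrow> 'a measure) \<Rightarrow> (real \<Rightarrow> 'a \<Rightarrow> real) \<Rightarrow> bool" where
  "brownian_motion M F W \<longleftrightarrow> adapted M F W \<and>
     (\<forall>\<omega>\<in>space M. W 0 \<omega> = 0 \<and> continuous_on {0..} (\<lambda>t. W t \<omega>)) \<and>
     (\<forall>s t. 0 \<le> s \<longrightarrow> s < t \<longrightarrow>
        distributed M lborel (\<lambda>\<omega>. W t \<omega> - W s \<omega>) (\<lambda>y. ennreal (normal_density 0 (sqrt (t - s)) y)) \<and>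
        (\<forall>A\<in>sets (F s). \<forall>B\<in>sets borel.
           measure M (A \<inter> ((\<lambda>\<omega>. W t \<omega> - W s \<omega>) -` B \<inter> space M))
             = measure M A * measure M ((\<lambda>\<omega>. W t \<omega> - W s \<omega>) -` B \<inter> space M)))"

text \<open>X is a (strong) solution of dX = b(X) dt + sig(X) dW, X_0 = x, characterised by:
  X continuous adapted, and with Mt = X_t - x - int_0^t b(X_s) ds, the processes
  Mt, Mt^2 - int_0^t sig(X_s)^2 ds and Mt W_t - int_0^t sig(X_s) ds are martingales
  (i.e. Mt is a continuous square integrable martingale with <M> = int sig^2 and
  <M,W> = int sig(X), which forces Mt = int_0^t sig(X_s) dW_s).\<close>
definition sde_solution ::
  "'a measure \<Rightarrow> (real \<Rightarrow> 'a measure) \<Rightarrow> (real \<Rightarrow> 'a \<Rightarrow> real) \<Rightarrow> (real \<Rightarrow> real) \<Rightarrow> (real \<Rightarrow> real)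
     \<Rightarrow> real \<Rightarrow> (real \<Rightarrow> 'a \<Rightarrow> real) \<Rightarrow> bool" where
  "sde_solution M F W b sig x X \<longleftrightarrow> adapted M F X \<and>
     (\<forall>\<omega>\<in>space M. X 0 \<omega> = x \<and> continuous_on {0..} (\<lambda>t. X t \<omega>)) \<and>
     (let Mt = (\<lambda>t \<omega>. X t \<omega> - x - (\<integral>s. b (X s \<omega>) \<partial>(restrict_space lborel {0..t})))
      in martingale M F Mt \<and>
         martingale M F (\<lambda>t \<omega>. (Mt t \<omega>)\<^sup>2 - (\<integral>s. (sig (X s \<omega>))\<^sup>2 \<partial>(restrict_space lborel {0..t}))) \<and>
         martingale M F (\<lambda>t \<omega>. Mt t \<omega> * W t \<omega> - (\<integral>s. sig (X s \<omega>) \<partial>(restrict_space lborel {0..t}))))"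

definition R_fun :: "real \<Rightarrow> real" where
  "R_fun y = (if y = 0 then 0 else y - y * ln y)"

definition progressive :: "'a measure \<Rightarrow> (real \<Rightarrow> 'a measure) \<Rightarrow> (real \<Rightarrow> 'a \<Rightarrow> real) \<Rightarrow> bool" where
  "progressive M F p \<longleftrightarrow>
     (\<forall>t\<ge>0. (\<lambda>(s, \<omega>). p s \<omega>) \<in> borel_measurable (restrict_space lborel {0..t} \<Otimes>\<^sub>M F t))"

definition discount :: "real \<Rightarrow> (real \<Rightarrow> 'a \<Rightarrow> real) \<Rightarrow> real \<Rightarrow> 'a \<Rightarrow> real" where
  "discount r p t \<omega> =
     (let I = (\<integral>\<^sup>+ s\<in>{0..t}. ennreal (r + p s \<omega>) \<partial>lborel)
      in if I = \<infinity> then 0 else exp (- enn2real I))"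

definition cost ::
  "'a measure \<Rightarrow> (real \<Rightarrow> real \<Rightarrow> 'a \<Rightarrow> real) \<Rightarrow> (real \<Rightarrow> real) \<Rightarrow> real \<Rightarrow> real
     \<Rightarrow> (real \<Rightarrow> real) \<Rightarrow> real \<Rightarrow> (real \<Rightarrow> 'a \<Rightarrow> real) \<Rightarrow> ereal" where
  "cost M X f r lam phi x p =
     (let g = (\<lambda>t \<omega>. discount r p t \<omega> *
                (f (X x t \<omega>) - lam * R_fun (p t \<omega>) + p t \<omega> * phi (X x t \<omega>)))
      in enn2ereal (\<integral>\<^sup>+ \<omega>. (\<integral>\<^sup>+ t\<in>{0..}. ennreal (g t \<omega>) \<partial>lborel) \<partial>M)
         - enn2ereal (\<integral>\<^sup>+ \<omega>. (\<integral>\<^sup>+ t\<in>{0..}. ennreal (- g t \<omega>) \<partial>lborel) \<partial>M))"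

definition T_op ::
  "'a measure \<Rightarrow> (real \<Rightarrow> 'a measure) \<Rightarrow> (real \<Rightarrow> real \<Rightarrow> 'a \<Rightarrow> real) \<Rightarrow> (real \<Rightarrow> real) \<Rightarrow> real
     \<Rightarrow> real \<Rightarrow> (real \<Rightarrow> real) \<Rightarrow> real \<Rightarrow> ereal" where
  "T_op M F X f r lam phi x =
     (INF p \<in> {p. progressive M F p \<and> (\<forall>t\<ge>0. \<forall>\<omega>\<in>space M. 0 \<le> p t \<omega>)}. cost M X f r lam phi x p)"

definition gauss_shift :: "real \<Rightarrow> real measure" where
  "gauss_shift x = density lborel (\<lambda>\<xi>. ennreal (normal_density (- x) 1 \<xi>))"

definition KL_div :: "'b measure \<Rightarrow> 'b measure \<Rightarrow> ereal" where
  "KL_div mu nu = ext_integral mu (\<lambda>\<xi>. ln (enn2real (RN_deriv nu mu \<xi>)))"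

definition M_op :: "(real \<Rightarrow> real) \<Rightarrow> real \<Rightarrow> (real \<Rightarrow> real) \<Rightarrow> real \<Rightarrow> ereal" where
  "M_op l lam phi x =
     (INF mu \<in> {mu. prob_space mu \<and> sets mu = sets borel \<and> absolutely_continuous (gauss_shift x) mu}.
        ext_integral mu (\<lambda>\<xi>. phi (x + \<xi>) + l \<xi>) + ereal lam * KL_div mu (gauss_shift x))"

definition calT ::
  "'a measure \<Rightarrow> (real \<Rightarrow> 'a measure) \<Rightarrow> (real \<Rightarrow> real \<Rightarrow> 'a \<Rightarrow> real) \<Rightarrow> (real \<Rightarrow> real) \<Rightarrow> real
     \<Rightarrow> (real \<Rightarrow> real) \<Rightarrow> real \<Rightarrow> real \<Rightarrow> (real \<Rightarrow> real) \<Rightarrow> real \<Rightarrow> ereal" where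
  "calT M F X f r l lam1 lam2 phi = T_op M F X f r lam1 (\<lambda>y. real_of_ereal (M_op l lam2 phi y))"

end

theory Submission
  imports Defs
begin

text \<open>
  By the Gibbs variational principle, the impulse operator is
  \<open>m \<phi> x = - \<lambda> ln E [exp (- (\<phi> Z + l (Z - x)) / \<lambda>)]\<close> with \<open>Z\<close> standard normal. As \<open>l\<close> is Lipschitz,
  \<open>m \<phi> x = l (- x) + O(1)\<close> for every \<open>\<phi>\<close>, so any two fixed points \<open>\<psi>1\<close>, \<open>\<psi>2\<close> differ by a bounded
  function. Suppose \<open>S = sup (\<psi>1 - \<psi>2) > 0\<close>. Both operators are monotone and do not expand upper
  bounds on differences. The entropy keeps near-optimal killing rates from being infinitely large,
  and the discount \<open>r > 0\<close> then makes \<open>\<psi>1 - \<psi>2\<close> at most some \<open>\<kappa> S < S\<close> on \<open>{-1..1}\<close>. The Gibbs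
  measures charge this interval uniformly in \<open>x\<close>, so \<open>m \<psi>1 - m \<psi>2 \<le> S - \<eta>\<close> everywhere for some
  \<open>\<eta> > 0\<close>, whence \<open>\<psi>1 - \<psi>2 \<le> max 0 (S - \<eta>) < S\<close>, a contradiction. The diffusion enters only
  through the joint measurability of its paths.
\<close>

section \<open>Extended-real integrals with finite negative part\<close>

lemma ext_integral_integrable:
  assumes "integrable N h"
  shows "ext_integral N h = ereal (\<integral>z. h z \<partial>N)"
proof -
  have fin: "(\<integral>\<^sup>+ z. ennreal (h z) \<partial>N) \<noteq> \<infinity>" "(\<integral>\<^sup>+ z. ennreal (- h z) \<partial>N) \<noteq> \<infinity>"
    using assms by (auto simp: real_integrable_def)
  show ?thesis
    unfolding ext_integral_def real_lebesgue_integral_def[OF assms] ereal_minus(1)[symmetric]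
    using fin by (metis enn2ereal_ennreal enn2real_nonneg ennreal_enn2real_if infinity_ennreal_def)
qed

lemma integrable_nn_integral_finite: "integrable N h \<Longrightarrow> (\<integral>\<^sup>+ z. ennreal (h z) \<partial>N) < \<infinity>"
  for h :: "_ \<Rightarrow> real"
  by (auto simp: real_integrable_def top.not_eq_extremum)

lemma ext_integral_cases:
  assumes [measurable]: "h \<in> borel_measurable N"
    and neg: "(\<integral>\<^sup>+ z. ennreal (- h z) \<partial>N) < \<infinity>"
  shows "ext_integral N h = \<infinity> \<or> integrable N h"
proof (cases "(\<integral>\<^sup>+ z. ennreal (h z) \<partial>N) = \<infinity>")
  case True
  then show ?thesis by (simp add: ext_integral_def)
next
  case False
  with neg show ?thesis by (auto simp: real_integrable_def)
qed

lemma ext_integral_cong_AE: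
  assumes "AE z in N. g z = h z"
  shows "ext_integral N g = ext_integral N h"
proof -
  have "(\<integral>\<^sup>+ z. ennreal (g z) \<partial>N) = (\<integral>\<^sup>+ z. ennreal (h z) \<partial>N)"
       "(\<integral>\<^sup>+ z. ennreal (- g z) \<partial>N) = (\<integral>\<^sup>+ z. ennreal (- h z) \<partial>N)"
    using assms by (auto intro!: nn_integral_cong_AE)
  then show ?thesis by (simp add: ext_integral_def)
qed

text \<open>Finite negative parts rule out a difference of two infinities. If the integral of
  \<open>v\<close> is infinite there is nothing to prove; otherwise \<open>v + w\<close> dominates
  the positive part of \<open>u\<close>, so \<open>u\<close> is integrable and real integrals can be
  compared.\<close>

lemma ext_integral_le_add:
  assumes [measurable]: "u \<in> borel_measurable N" "v \<in> borel_measurable N" "integrable N w"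
    and le: "\<And>z. z \<in> space N \<Longrightarrow> u z \<le> v z + w z"
    and neg: "(\<integral>\<^sup>+ z. ennreal (- u z) \<partial>N) < \<infinity>" "(\<integral>\<^sup>+ z. ennreal (- v z) \<partial>N) < \<infinity>"
  shows "ext_integral N u \<le> ext_integral N v + ereal (\<integral>z. w z \<partial>N)"
  using ext_integral_cases[OF assms(2) neg(2)]
proof
  assume "integrable N v"
  then have vw: "integrable N (\<lambda>z. v z + w z)" using assms(3) by simp
  have "(\<integral>\<^sup>+ z. ennreal (u z) \<partial>N) \<le> (\<integral>\<^sup>+ z. ennreal (v z + w z) \<partial>N)"
    by (intro nn_integral_mono ennreal_leI le)
  also have "\<dots> < \<infinity>" using vw by (rule integrable_nn_integral_finite)
  finally have u: "integrable N u" using neg(1) by (auto simp: real_integrable_def)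
  have "(\<integral>z. u z \<partial>N) \<le> (\<integral>z. v z + w z \<partial>N)"
    by (rule integral_mono[OF u vw le])
  then show ?thesis
    using u vw \<open>integrable N v\<close> assms(3) by (simp add: ext_integral_integrable)
qed simp

section \<open>Gibbs variational principle\<close>

text \<open>The lower bound comes from integrating \<open>1 - y \<le> - ln y\<close> against
  \<open>\<mu>\<close>, with \<open>y\<close> the ratio of the tilted density \<open>e / Z\<close>
  to the density of \<open>\<mu>\<close>. The tilted measure itself attains the bound. That
  \<open>h\<close> is bounded below keeps \<open>e\<close> bounded and the negative part of
  \<open>h\<close> integrable.\<close>

lemma gibbs_variational:
  fixes h :: "'b \<Rightarrow> real"
  assumes "prob_space \<nu>" and [measurable]: "h \<in> borel_measurable \<nu>"
    and lower: "\<And>z. - c \<le> h z" and lam: "0 < lam"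
  shows "(INF \<mu> \<in> {\<mu>. prob_space \<mu> \<and> sets \<mu> = sets \<nu> \<and> absolutely_continuous \<nu> \<mu>}.
            ext_integral \<mu> h + ereal lam * KL_div \<mu> \<nu>)
         = ereal (- lam * ln (\<integral>z. exp (- h z / lam) \<partial>\<nu>))" (is "Inf (?J ` ?A) = ereal ?v")
proof -
  interpret \<nu>: prob_space \<nu> by fact
  define e where "e z = exp (- h z / lam)" for z
  have [measurable]: "e \<in> borel_measurable \<nu>" by (simp add: e_def[abs_def])
  have e_pos: "0 < e z" for z by (simp add: e_def)
  have e_le: "e z \<le> exp (c / lam)" for z
    using divide_right_mono[of "- h z" c lam] lower[of z] lam by (simp add: e_def)
  have e_int: "integrable \<nu> e"
    using e_pos e_le by (intro \<nu>.integrable_const_bound[of _ "exp (c/lam)"]) (auto simp: less_imp_le)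
  define Z where "Z = (\<integral>z. e z \<partial>\<nu>)"
  have "Z \<noteq> 0"
  proof
    assume "Z = 0"
    then have "AE z in \<nu>. e z = 0"
      unfolding Z_def using e_int e_pos by (subst (asm) integral_nonneg_eq_0_iff_AE) (auto simp: less_imp_le)
    then have "AE z in \<nu>. False" by eventually_elim (metis e_pos less_irrefl)
    then show False by simp
  qed
  moreover have "0 \<le> Z" unfolding Z_def using e_pos by (intro integral_nonneg_AE) (simp add: less_imp_le)
  ultimately have Z: "0 < Z" by simp
  have nn_e: "(\<integral>\<^sup>+ z. ennreal (e z / Z) \<partial>\<nu>) = 1"
  proof -
    have "(\<integral>\<^sup>+ z. ennreal (e z / Z) \<partial>\<nu>) = ennreal (\<integral>z. e z / Z \<partial>\<nu>)"
      using e_int e_pos Z by (intro nn_integral_eq_integral) (auto simp: less_imp_le)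
    also have "(\<integral>z. e z / Z \<partial>\<nu>) = 1" using Z by (simp add: Z_def)
    finally show ?thesis by simp
  qed
  have v: "?v = - lam * ln Z" by (simp add: Z_def e_def)
  have lb: "ereal (- lam * ln Z) \<le> ?J \<mu>" if "\<mu> \<in> ?A" for \<mu>
  proof -
    interpret \<mu>: prob_space \<mu> using that by simp
    have sets[measurable_cong]: "sets \<mu> = sets \<nu>" and ac: "absolutely_continuous \<nu> \<mu>" using that by auto
    define D where "D = RN_deriv \<nu> \<mu>"
    have [measurable]: "D \<in> borel_measurable \<nu>" by (simp add: D_def)
    have D: "density \<nu> D = \<mu>" unfolding D_def by (rule \<nu>.density_RN_deriv[OF ac sets])
    have D_fin: "AE z in \<nu>. D z \<noteq> \<infinity>"
      unfolding D_def by (rule \<nu>.RN_deriv_finite[OF _ ac sets]) unfold_locales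
    define \<rho> where "\<rho> z = enn2real (D z)" for z
    have [measurable]: "\<rho> \<in> borel_measurable \<nu>" by (simp add: \<rho>_def[abs_def])
    have \<rho>_nonneg: "0 \<le> \<rho> z" for z by (simp add: \<rho>_def)
    have nn_mu: "(\<integral>\<^sup>+ z. g z \<partial>\<mu>) = (\<integral>\<^sup>+ z. D z * g z \<partial>\<nu>)" if [measurable]: "g \<in> borel_measurable \<nu>" for g
      by (subst D[symmetric], subst nn_integral_density) auto
    have \<rho>_pos: "AE z in \<mu>. 0 < \<rho> z"
      by (subst D[symmetric], subst AE_density)
        (use D_fin in \<open>auto simp: \<rho>_def enn2real_positive_iff top.not_eq_extremum\<close>)
    have D_eq: "AE z in \<nu>. D z = ennreal (\<rho> z)"
      using D_fin by eventually_elim (simp add: \<rho>_def top.not_eq_extremum)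
    have KL: "KL_div \<mu> \<nu> = ext_integral \<mu> (\<lambda>z. ln (\<rho> z))" by (simp add: KL_div_def \<rho>_def D_def)
    have neg_h: "(\<integral>\<^sup>+ z. ennreal (- h z) \<partial>\<mu>) < \<infinity>"
    proof -
      have "(\<integral>\<^sup>+ z. ennreal (- h z) \<partial>\<mu>) \<le> (\<integral>\<^sup>+ z. ennreal c \<partial>\<mu>)"
        by (intro nn_integral_mono ennreal_leI) (use lower in \<open>simp add: minus_le_iff\<close>)
      then show ?thesis by (simp add: \<mu>.emeasure_space_1 order_le_less_trans)
    qed
    \<comment> \<open>Relative entropy has no infinite negative part:
      \<open>- \<rho> ln \<rho> \<le> 1\<close>, which follows from
      \<open>ln (1 / \<rho>) \<le> 1 / \<rho> - 1\<close>.\<close>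
    have neg_ln: "(\<integral>\<^sup>+ z. ennreal (- ln (\<rho> z)) \<partial>\<mu>) < \<infinity>"
    proof -
      have "(\<integral>\<^sup>+ z. ennreal (- ln (\<rho> z)) \<partial>\<mu>) = (\<integral>\<^sup>+ z. D z * ennreal (- ln (\<rho> z)) \<partial>\<nu>)"
        by (rule nn_mu) simp
      also have "\<dots> \<le> (\<integral>\<^sup>+ z. 1 \<partial>\<nu>)"
      proof (intro nn_integral_mono_AE, use D_eq in eventually_elim)
        case (elim z)
        have "- (\<rho> z * ln (\<rho> z)) \<le> 1"
        proof (cases "\<rho> z = 0")
          case False
          then have pos: "0 < \<rho> z" by (simp add: \<rho>_def order_less_le)
          have "- ln (\<rho> z) \<le> 1 / \<rho> z - 1"
            using ln_le_minus_one[of "1 / \<rho> z"] pos by (simp add: ln_div)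
          then show ?thesis using pos by (simp add: field_simps)
        qed simp
        then have "ennreal (\<rho> z * - ln (\<rho> z)) \<le> 1" by (simp add: ennreal_le_1)
        then show ?case unfolding elim by (subst (asm) ennreal_mult') (simp_all add: \<rho>_nonneg)
      qed
      also have "\<dots> < \<infinity>" by (simp add: \<nu>.emeasure_space_1)
      finally show ?thesis .
    qed
    \<comment> \<open>In the first two cases the functional is infinite, so only the integrable case
      has content.\<close>
    consider "ext_integral \<mu> h = \<infinity>" | "KL_div \<mu> \<nu> = \<infinity>"
      | "integrable \<mu> h" "integrable \<mu> (\<lambda>z. ln (\<rho> z))"
      using ext_integral_cases[OF _ neg_h] ext_integral_cases[OF _ neg_ln] KL by auto
    then show ?thesis
    proof cases
      case 3
      \<comment> \<open>Where \<open>\<rho>\<close> vanishes, division by zero makes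
        \<open>y\<close> zero. The \<open>\<mu>\<close>-integral of \<open>y\<close> can therefore
        fall short of 1, and only \<open>\<le> 1\<close> is claimed and used.\<close>
      define y where "y z = e z / (\<rho> z * Z)" for z
      have [measurable]: "y \<in> borel_measurable \<nu>" by (simp add: y_def[abs_def])
      have y_nonneg: "0 \<le> y z" for z using e_pos[of z] Z by (simp add: y_def \<rho>_def)
      have "(\<integral>\<^sup>+ z. ennreal (y z) \<partial>\<mu>) = (\<integral>\<^sup>+ z. D z * ennreal (y z) \<partial>\<nu>)"
        by (rule nn_mu) simp
      also have "\<dots> \<le> (\<integral>\<^sup>+ z. ennreal (e z / Z) \<partial>\<nu>)"
      proof (intro nn_integral_mono_AE, use D_eq in eventually_elim)
        case (elim z)
        have "\<rho> z * y z \<le> e z / Z" using e_pos[of z] Z by (simp add: y_def)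
        then have "ennreal (\<rho> z * y z) \<le> ennreal (e z / Z)" by (rule ennreal_leI)
        then show ?case unfolding elim by (subst (asm) ennreal_mult') (simp_all add: \<rho>_nonneg)
      qed
      finally have y_nn: "(\<integral>\<^sup>+ z. ennreal (y z) \<partial>\<mu>) \<le> 1" by (simp add: nn_e)
      then have y_int: "integrable \<mu> y"
        using y_nonneg by (intro integrableI_nonneg) (auto simp: order_le_less_trans)
      have y1: "(\<integral>z. y z \<partial>\<mu>) \<le> 1"
        using y_nn nn_integral_eq_integral[OF y_int] y_nonneg by simp
      have "0 \<le> (\<integral>z. 1 - y z \<partial>\<mu>)" using y1 y_int by (simp add: \<mu>.prob_space)
      also have "\<dots> \<le> (\<integral>z. h z / lam + ln (\<rho> z) + ln Z \<partial>\<mu>)"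
      proof (rule integral_mono_AE)
        show "AE z in \<mu>. 1 - y z \<le> h z / lam + ln (\<rho> z) + ln Z"
          using \<rho>_pos
        proof eventually_elim
          case (elim z)
          have "ln (y z) \<le> y z - 1" using elim e_pos[of z] Z by (intro ln_le_minus_one) (simp add: y_def)
          moreover have "ln (y z) = - h z / lam - ln (\<rho> z) - ln Z"
            using elim e_pos[of z] Z by (simp add: y_def ln_div ln_mult) (simp add: e_def)
          ultimately show ?case by simp
        qed
      qed (use 3 y_int in auto)
      also have "\<dots> = (\<integral>z. h z \<partial>\<mu>) / lam + (\<integral>z. ln (\<rho> z) \<partial>\<mu>) + ln Z"
        using 3 by (simp add: \<mu>.prob_space)
      finally have "- lam * ln Z \<le> (\<integral>z. h z \<partial>\<mu>) + lam * (\<integral>z. ln (\<rho> z) \<partial>\<mu>)"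
        using lam by (simp add: field_simps)
      then show ?thesis using 3 by (simp add: KL ext_integral_integrable)
    qed (use lam in auto)
  qed
  \<comment> \<open>The minimiser: the Gibbs measure with density proportional to
    \<open>e\<close>.\<close>
  define \<mu> where "\<mu> = density \<nu> (\<lambda>z. ennreal (e z / Z))"
  have prob: "prob_space \<mu>"
    by (rule prob_spaceI) (simp add: \<mu>_def emeasure_density nn_e cong: nn_integral_cong)
  interpret \<mu>: prob_space \<mu> by (rule prob)
  have mem: "\<mu> \<in> ?A"
    using prob by (auto simp: \<mu>_def intro!: absolutely_continuousI_density)
  have h_int: "integrable \<mu> h"
  proof -
    \<comment> \<open>The function \<open>h exp (- h / lam)\<close> is at most \<open>lam\<close>,
      since \<open>t \<le> exp t\<close>, and is bounded below because \<open>h\<close> is. Hence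
      \<open>h\<close> is integrable under the Gibbs measure even when it is unbounded.\<close>
    have bd: "\<bar>e z / Z * h z\<bar> \<le> (exp (c / lam) * \<bar>c\<bar> + lam) / Z" for z
    proof -
      have "h z / lam \<le> exp (h z / lam)" using exp_ge_add_one_self[of "h z / lam"] by linarith
      then have 1: "e z * h z \<le> lam" using lam by (simp add: e_def exp_minus field_simps)
      have "e z * - c \<le> e z * h z" using lower[of z] e_pos[of z] by (intro mult_left_mono) auto
      moreover have "\<bar>c\<bar> * e z \<le> \<bar>c\<bar> * exp (c / lam)" using e_le by (intro mult_left_mono) auto
      moreover have "e z * - \<bar>c\<bar> \<le> e z * - c" using e_pos[of z] by (intro mult_left_mono) auto
      ultimately have "- (exp (c / lam) * \<bar>c\<bar>) \<le> e z * h z" by (simp add: mult.commute)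
      moreover have "0 \<le> exp (c / lam) * \<bar>c\<bar>" by simp
      ultimately have "\<bar>e z * h z\<bar> \<le> exp (c / lam) * \<bar>c\<bar> + lam" using 1 lam by linarith
      then have "\<bar>e z * h z\<bar> / Z \<le> (exp (c / lam) * \<bar>c\<bar> + lam) / Z" using Z by (intro divide_right_mono) auto
      then show ?thesis using Z by (simp add: abs_mult)
    qed
    have "integrable \<nu> (\<lambda>z. e z / Z * h z)"
      by (rule \<nu>.integrable_const_bound[of _ "(exp (c / lam) * \<bar>c\<bar> + lam) / Z"]) (use bd in auto)
    then show ?thesis
      unfolding \<mu>_def using e_pos Z by (subst integrable_density) (auto simp: less_imp_le)
  qed
  have "AE z in \<nu>. ennreal (e z / Z) = RN_deriv \<nu> \<mu> z"
    by (rule \<nu>.RN_deriv_unique) (auto simp: \<mu>_def)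
  then have "AE z in \<mu>. ennreal (e z / Z) = RN_deriv \<nu> \<mu> z"
    unfolding \<mu>_def by (subst AE_density) auto
  \<comment> \<open>The log-density is affine in \<open>h\<close>, so in the functional the entropy
    cancels the integral of \<open>h\<close> and leaves only \<open>- lam * ln Z\<close>.\<close>
  then have "AE z in \<mu>. ln (enn2real (RN_deriv \<nu> \<mu> z)) = - h z / lam - ln Z"
  proof eventually_elim
    case (elim z)
    then have "enn2real (RN_deriv \<nu> \<mu> z) = e z / Z"
      using e_pos[of z] Z by (metis enn2real_ennreal divide_nonneg_pos less_imp_le)
    then show ?case using e_pos[of z] Z by (simp add: ln_div) (simp add: e_def)
  qed
  then have "KL_div \<mu> \<nu> = ext_integral \<mu> (\<lambda>z. - h z / lam - ln Z)"
    unfolding KL_div_def by (rule ext_integral_cong_AE)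
  also have "\<dots> = ereal (- (\<integral>z. h z \<partial>\<mu>) / lam - ln Z)"
    using h_int by (subst ext_integral_integrable) (auto simp: \<mu>.prob_space)
  finally have "?J \<mu> = ereal (- lam * ln Z)"
    using h_int lam by (simp add: ext_integral_integrable field_simps)
  then show ?thesis
    unfolding v by (metis (no_types, lifting) mem lb INF_greatest INF_lower order_antisym)
qed

section \<open>Total killing mass along one path\<close>

text \<open>Closed intervals \<open>{0..T n}\<close> with endpoints in \<open>S\<close> exhaust
  \<open>S\<close>, and each carries at most \<open>y\<close> by the definition of \<open>S\<close>;
  monotone convergence concludes. Working with endpoints avoids continuity of the primitive, which
  may jump to infinity.\<close>

lemma nn_integral_initial_segment_le:
  fixes u :: "real \<Rightarrow> ennreal" and y :: ennreal
  assumes [measurable]: "u \<in> borel_measurable lborel"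
  defines "S \<equiv> {t. 0 \<le> t \<and> (\<integral>\<^sup>+ s\<in>{0..t}. u s \<partial>lborel) \<le> y}"
  shows "(\<integral>\<^sup>+ s\<in>S. u s \<partial>lborel) \<le> y"
proof -
  define A where "A t = (\<integral>\<^sup>+ s\<in>{0..t}. u s \<partial>lborel)" for t
  have A_mono: "A s \<le> A t" if "s \<le> t" for s t
    unfolding A_def using that by (intro nn_integral_mono) (auto split: split_indicator)
  have S: "t \<in> S \<longleftrightarrow> 0 \<le> t \<and> A t \<le> y" for t by (simp add: S_def A_def)
  have down: "s \<in> S" if "t \<in> S" "0 \<le> s" "s \<le> t" for s t
    using that A_mono[of s t] by (auto simp: S)
  \<comment> \<open>A single point is null, so the primitive vanishes at 0 even if \<open>u\<close>
    is infinite there.\<close>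
  have "0 \<in> S"
  proof -
    have "A 0 = (\<integral>\<^sup>+ (s::real). 0 \<partial>lborel)"
      unfolding A_def
    proof (rule nn_integral_cong_AE)
      show "AE s in lborel. u s * indicator {0..0} s = 0"
        using AE_lborel_singleton[of 0] by eventually_elim (simp split: split_indicator)
    qed
    then show ?thesis by (simp add: S)
  qed
  obtain T :: "nat \<Rightarrow> real" where T: "incseq T" "\<And>n. T n \<in> S" "S = (\<Union>n. {0..T n})"
  proof -
    consider (max) t where "t \<in> S" "\<And>s. s \<in> S \<Longrightarrow> s \<le> t"
      | (unbdd) "\<not> bdd_above S"
      | (sup) "bdd_above S" "Sup S \<notin> S"
      using cSup_upper by metis
    then show thesis
    proof cases
      case max
      then have eq: "S = {0..t}" using down by (auto simp: S)
      show thesis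
      proof (rule that[of "\<lambda>_. t"])
        show "S = (\<Union>n::nat. {0..t})" using eq by (rule trans) simp
      qed (rule monoI order_refl max)+
    next
      case unbdd
      then have all: "t \<in> S" if "0 \<le> t" for t
        using down that unfolding bdd_above_def by (metis linear)
      show thesis
      proof (rule that[of real])
        show "S = (\<Union>n. {0..real n})"
        proof (intro set_eqI iffI)
          fix t assume "t \<in> S"
          moreover obtain n where "t \<le> real n" using real_arch_simple by blast
          ultimately show "t \<in> (\<Union>n. {0..real n})" by (auto simp: S)
        qed (use all in auto)
        show "real n \<in> S" for n by (rule all) simp
      qed (simp add: incseq_def)
    next
      case sup
      \<comment> \<open>Points below the supremum lie in \<open>S\<close>, and the clipping at 0
        keeps them in the time domain. The supremum is positive here because
        \<open>0 \<in> S\<close> and it is not itself in \<open>S\<close>.\<close>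
      define T where "T n = max 0 (Sup S - 1 / (real n + 1))" for n :: nat
      have sup_pos: "0 < Sup S"
        using sup \<open>0 \<in> S\<close> cSup_upper[of 0 S] by (metis order_le_less)
      have T_lt: "T n < Sup S" for n using sup_pos by (simp add: T_def)
      have T_in: "T n \<in> S" for n
      proof -
        obtain t where "t \<in> S" "T n < t"
          using less_cSupE[OF T_lt] \<open>0 \<in> S\<close> by (metis empty_iff)
        then show ?thesis using down[of t "T n"] by (simp add: T_def)
      qed
      have "incseq T"
        unfolding incseq_def T_def by (intro allI impI max.mono order_refl diff_left_mono divide_left_mono) auto
      moreover have "t \<in> (\<Union>n. {0..T n})" if "t \<in> S" for t
      proof -
        have "t < Sup S" using that sup cSup_upper by (metis order_le_less)
        then obtain n where "1 / (real n + 1) < Sup S - t"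
          using reals_Archimedean[of "Sup S - t"] by (auto simp: inverse_eq_divide add.commute)
        then have "t \<le> T n" by (simp add: T_def)
        then show ?thesis using that by (auto simp: S)
      qed
      moreover have "t \<in> S" if "t \<in> (\<Union>n. {0..T n})" for t
        using that down[OF T_in] by auto
      ultimately show thesis using T_in by (intro that[of T] set_eqI iffI)
    qed
  qed
  have "(\<integral>\<^sup>+ s\<in>S. u s \<partial>lborel) = (\<integral>\<^sup>+ s. (SUP n. u s * indicator {0..T n} s) \<partial>lborel)"
  proof (intro nn_integral_cong)
    fix s
    show "u s * indicator S s = (SUP n. u s * indicator {0..T n} s)"
    proof (cases "s \<in> S")
      case True
      then obtain n where "s \<in> {0..T n}" using T(3) by auto
      then have "u s = u s * indicator {0..T n} s" by simp
      also have "\<dots> \<le> (SUP n. u s * indicator {0..T n} s)" by (rule SUP_upper) simp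
      finally have "u s \<le> (SUP n. u s * indicator {0..T n} s)" .
      moreover have "(SUP n. u s * indicator {0..T n} s) \<le> u s"
        by (intro SUP_least) (simp split: split_indicator)
      ultimately show ?thesis using True by (simp add: antisym)
    next
      case False
      then have "s \<notin> {0..T n}" for n using T(3) by auto
      with False show ?thesis by simp
    qed
  qed
  also have "\<dots> = (SUP n. A (T n))"
    unfolding A_def
  proof (rule nn_integral_monotone_convergence_SUP)
    show "incseq (\<lambda>n s. u s * indicator {0..T n} s)"
      using T(1) by (auto simp: incseq_def le_fun_def split: split_indicator intro: order_trans)
  qed simp
  also have "\<dots> \<le> y" using T(2) by (auto simp: S intro: SUP_least)
  finally show "(\<integral>\<^sup>+ s\<in>S. u s \<partial>lborel) \<le> y" .
qed

lemma nn_integral_exp_neg_tail: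
  "(\<integral>\<^sup>+ y. ennreal (exp (- y)) * indicator {a..} y \<partial>lborel) = ennreal (exp (- a))"
proof -
  have lim: "((\<lambda>y. - exp (- y)) \<longlongrightarrow> (0::real)) at_top"
    using tendsto_minus[OF filterlim_compose[OF exp_at_bot filterlim_uminus_at_bot_at_top]] by simp
  have der: "((\<lambda>y. - exp (- y)) has_real_derivative exp (- y)) (at y)" for y :: real
    by (auto intro!: derivative_eq_intros)
  show ?thesis
    using nn_integral_FTC_atLeast[OF _ der _ lim, of a] by simp
qed

lemma nn_integral_y_exp_neg:
  "(\<integral>\<^sup>+ y. ennreal y * ennreal (exp (- y)) * indicator {0..} y \<partial>lborel) = 1"
  using nn_intergal_power_times_exp_Ici[of 1]
  by (simp add: ennreal_mult'' cong: nn_integral_cong)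

text \<open>Layer cake: \<open>exp (- A t)\<close> is the integral of \<open>exp (- y)\<close> over \<open>y \<ge> A t\<close>, and \<open>A\<close> increases
  by at most \<open>y\<close> before it exceeds \<open>y\<close>. The inequality is strict when \<open>A\<close> jumps to infinity.\<close>
lemma nn_integral_rate_discount_le:
  fixes u :: "real \<Rightarrow> ennreal"
  assumes [measurable]: "u \<in> borel_measurable lborel"
  defines "A \<equiv> \<lambda>t. \<integral>\<^sup>+ s\<in>{0..t}. u s \<partial>lborel"
  shows "(\<integral>\<^sup>+ t\<in>{0..}. u t * (if A t = \<infinity> then 0 else ennreal (exp (- enn2real (A t)))) \<partial>lborel) \<le> 1"
proof -
  have [measurable]: "A \<in> borel_measurable lborel"
  proof -
    \<comment> \<open>As a conditional the integrand is visibly measurable in the pair of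
      \<open>s\<close> and \<open>t\<close>, which gives measurability of the parametrised
      integral.\<close>
    have "A = (\<lambda>t. \<integral>\<^sup>+ s. (if 0 \<le> s \<and> s \<le> t then u s else 0) \<partial>lborel)"
      unfolding A_def by (intro ext nn_integral_cong) (simp split: split_indicator)
    then show ?thesis by simp
  qed
  \<comment> \<open>The factor \<open>indicator {0..} y\<close> matters: \<open>ennreal y\<close> is
    0 for negative \<open>y\<close>, so those \<open>y\<close> would otherwise contribute wherever
    \<open>A t = 0\<close>.\<close>
  have "(\<integral>\<^sup>+ t\<in>{0..}. u t * (if A t = \<infinity> then 0 else ennreal (exp (- enn2real (A t)))) \<partial>lborel)
     = (\<integral>\<^sup>+ t. (\<integral>\<^sup>+ y. u t * indicator {0..} t * (ennreal (exp (- y)) * indicator {y. A t \<le> ennreal y} y) * indicator {0..} y \<partial>lborel) \<partial>lborel)"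
  proof (rule nn_integral_cong)
    fix t :: real
    show "u t * (if A t = \<infinity> then 0 else ennreal (exp (- enn2real (A t)))) * indicator {0..} t
      = (\<integral>\<^sup>+ y. u t * indicator {0..} t * (ennreal (exp (- y)) * indicator {y. A t \<le> ennreal y} y) * indicator {0..} y \<partial>lborel)"
    proof (cases "A t = \<infinity>")
      case True
      then show ?thesis by (simp add: top_unique)
    next
      case False
      then have A: "A t = ennreal (enn2real (A t))" by (simp add: top.not_eq_extremum)
      have "(\<integral>\<^sup>+ y. u t * indicator {0..} t * (ennreal (exp (- y)) * indicator {y. A t \<le> ennreal y} y) * indicator {0..} y \<partial>lborel)
         = (\<integral>\<^sup>+ y. (u t * indicator {0..} t) * (ennreal (exp (- y)) * indicator {enn2real (A t)..} y) \<partial>lborel)"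
        by (intro nn_integral_cong, subst A)
           (use order_trans[OF enn2real_nonneg[of "A t"]] in \<open>auto split: split_indicator\<close>)
      also have "\<dots> = (u t * indicator {0..} t) * ennreal (exp (- enn2real (A t)))"
        by (subst nn_integral_cmult) (simp_all add: nn_integral_exp_neg_tail)
      finally show ?thesis using False by (simp add: ac_simps)
    qed
  qed
  also have "\<dots> = (\<integral>\<^sup>+ y. (\<integral>\<^sup>+ t. u t * indicator {0..} t * (ennreal (exp (- y)) * indicator {y. A t \<le> ennreal y} y) * indicator {0..} y \<partial>lborel) \<partial>lborel)"
    by (rule lborel_pair.Fubini') measurable
  also have "\<dots> \<le> (\<integral>\<^sup>+ y. ennreal y * ennreal (exp (- y)) * indicator {0..} y \<partial>lborel)"
  proof (rule nn_integral_mono)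
    fix y :: real
    have "(\<integral>\<^sup>+ t. u t * indicator {0..} t * (ennreal (exp (- y)) * indicator {y. A t \<le> ennreal y} y) * indicator {0..} y \<partial>lborel)
       = (\<integral>\<^sup>+ t\<in>{t. 0 \<le> t \<and> A t \<le> ennreal y}. u t \<partial>lborel) * (ennreal (exp (- y)) * indicator {0..} y)"
      by (subst nn_integral_multc[symmetric])
         (auto intro!: nn_integral_cong simp: ac_simps split: split_indicator)
    also have "\<dots> \<le> ennreal y * (ennreal (exp (- y)) * indicator {0..} y)"
      unfolding A_def by (intro mult_right_mono nn_integral_initial_segment_le) auto
    finally show "(\<integral>\<^sup>+ t. u t * indicator {0..} t * (ennreal (exp (- y)) * indicator {y. A t \<le> ennreal y} y) * indicator {0..} y \<partial>lborel)
      \<le> ennreal y * ennreal (exp (- y)) * indicator {0..} y" by (simp add: mult.assoc)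
  qed
  also have "\<dots> = 1" by (rule nn_integral_y_exp_neg)
  finally show ?thesis .
qed

section \<open>Joint measurability in chance and time\<close>

text \<open>Rounding time down to the grid of mesh \<open>1 / (n + 1)\<close> leaves countably many
  random variables, hence a jointly measurable map; path continuity gives convergence as the mesh
  shrinks. Time is clipped at 0 because nothing is known about negative times.\<close>

lemma measurable_continuous_process:
  fixes Y :: "real \<Rightarrow> 'a \<Rightarrow> real"
  assumes meas: "\<And>t. 0 \<le> t \<Longrightarrow> Y t \<in> borel_measurable M"
    and cont: "\<And>\<omega>. \<omega> \<in> space M \<Longrightarrow> continuous_on {0..} (\<lambda>t. Y t \<omega>)"
  shows "(\<lambda>z. Y (max 0 (snd z)) (fst z)) \<in> borel_measurable (M \<Otimes>\<^sub>M lborel)"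
proof (rule borel_measurable_LIMSEQ_real)
  define k where "k n t = nat \<lfloor>real (Suc n) * max 0 t\<rfloor>" for n and t :: real
  show "(\<lambda>z. Y (real (k n (snd z)) / real (Suc n)) (fst z)) \<in> borel_measurable (M \<Otimes>\<^sub>M lborel)" for n
  proof (rule measurable_compose_countable[where f = "\<lambda>i z. Y (real i / real (Suc n)) (fst z)"])
    show "(\<lambda>z. Y (real i / real (Suc n)) (fst z)) \<in> borel_measurable (M \<Otimes>\<^sub>M lborel)" for i
      by (rule measurable_compose[OF measurable_fst meas]) simp
    show "(\<lambda>z. k n (snd z)) \<in> M \<Otimes>\<^sub>M lborel \<rightarrow>\<^sub>M count_space UNIV"
      unfolding k_def by measurable
  qed
  fix z assume "z \<in> space (M \<Otimes>\<^sub>M (lborel :: real measure))"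
  then have \<omega>: "fst z \<in> space M" by (auto simp: space_pair_measure)
  show "(\<lambda>n. Y (real (k n (snd z)) / real (Suc n)) (fst z)) \<longlonglongrightarrow> Y (max 0 (snd z)) (fst z)"
  proof (rule continuous_on_tendsto_compose[OF cont[OF \<omega>]])
    have "\<bar>real (k n (snd z)) / real (Suc n) - max 0 (snd z)\<bar> \<le> inverse (real (Suc n))" for n
    proof -
      have "real (k n (snd z)) \<le> real (Suc n) * max 0 (snd z)"
           "real (Suc n) * max 0 (snd z) \<le> real (k n (snd z)) + 1"
        using floor_correct[of "real (Suc n) * max 0 (snd z)"] unfolding k_def
        by (simp_all add: of_nat_nat del: of_nat_Suc)
      then have "\<bar>real (k n (snd z)) - real (Suc n) * max 0 (snd z)\<bar> \<le> 1" by simp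
      then have "\<bar>real (k n (snd z)) - real (Suc n) * max 0 (snd z)\<bar> / real (Suc n) \<le> 1 / real (Suc n)"
        by (intro divide_right_mono) auto
      also have "\<bar>real (k n (snd z)) - real (Suc n) * max 0 (snd z)\<bar> / real (Suc n)
          = \<bar>real (k n (snd z)) / real (Suc n) - max 0 (snd z)\<bar>"
        by (subst abs_of_pos[of "real (Suc n)", symmetric], simp, subst abs_divide[symmetric])
          (simp add: diff_divide_distrib del: of_nat_Suc)
      finally show ?thesis by (simp add: inverse_eq_divide)
    qed
    then have "(\<lambda>n. real (k n (snd z)) / real (Suc n) - max 0 (snd z)) \<longlonglongrightarrow> 0"
      by (intro Lim_null_comparison[OF _ LIMSEQ_inverse_real_of_nat]) auto
    then show "(\<lambda>n. real (k n (snd z)) / real (Suc n)) \<longlonglongrightarrow> max 0 (snd z)"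
      using Lim_null by blast
  qed auto
qed

text \<open>Clipping time to \<open>{0..real n}\<close> lands where progressive measurability at
  time \<open>n\<close> applies, and for fixed time the clipping has no effect once \<open>n\<close>
  is large.\<close>

lemma measurable_progressive:
  assumes F: "usual_filtration M F" and p: "progressive M F p"
  shows "(\<lambda>z. p (max 0 (snd z)) (fst z)) \<in> borel_measurable (M \<Otimes>\<^sub>M lborel)"
proof (rule borel_measurable_LIMSEQ_real)
  fix n :: nat
  have "subalgebra M (F (real n))" using F by (simp add: usual_filtration_def)
  then have "(\<lambda>\<omega>. \<omega>) \<in> M \<rightarrow>\<^sub>M F (real n)"
    by (rule measurable_from_subalg) simp
  then have fst: "fst \<in> M \<Otimes>\<^sub>M lborel \<rightarrow>\<^sub>M F (real n)"
    using measurable_compose[OF measurable_fst] by (metis (no_types, lifting) measurable_cong)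
  have clip: "(\<lambda>z. (max 0 (min (real n) (snd z)), fst z))
      \<in> M \<Otimes>\<^sub>M lborel \<rightarrow>\<^sub>M restrict_space lborel {0..real n} \<Otimes>\<^sub>M F (real n)"
    using fst by (intro measurable_Pair measurable_restrict_space2) auto
  have "(\<lambda>(s, \<omega>). p s \<omega>) \<in> borel_measurable (restrict_space lborel {0..real n} \<Otimes>\<^sub>M F (real n))"
    using p by (simp add: progressive_def)
  from measurable_compose[OF clip this]
  show "(\<lambda>z. p (max 0 (min (real n) (snd z))) (fst z)) \<in> borel_measurable (M \<Otimes>\<^sub>M lborel)"
    by simp
next
  fix z :: "'a \<times> real"
  obtain n0 :: nat where "snd z \<le> real n0" using real_arch_simple by blast
  then have "eventually (\<lambda>n. p (max 0 (min (real n) (snd z))) (fst z) = p (max 0 (snd z)) (fst z)) sequentially"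
    by (auto simp: eventually_sequentially min_absorb2 intro!: exI[of _ n0])
  then show "(\<lambda>n. p (max 0 (min (real n) (snd z))) (fst z)) \<longlonglongrightarrow> p (max 0 (snd z)) (fst z)"
    by (rule tendsto_eventually)
qed

section \<open>The cost of one control as an integral over an occupation measure\<close>

text \<open>The right side is the tangent at \<open>N\<close> of the concave function
  \<open>R_fun\<close>. The choice \<open>N = 1\<close> bounds the entropy by 1; large
  \<open>N\<close> makes each unit of rate expensive.\<close>

lemma R_fun_le: "0 < N \<Longrightarrow> 0 \<le> y \<Longrightarrow> R_fun y \<le> N - y * ln N"
proof (cases "y = 0")
  case False
  assume "0 < N" "0 \<le> y"
  with False have y: "0 < y" by simp
  have "ln (N / y) \<le> N / y - 1" using \<open>0 < N\<close> y by (intro ln_le_minus_one) simp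
  then have "y * ln (N / y) \<le> y * (N / y - 1)" using y by (intro mult_left_mono) auto
  then show ?thesis using y \<open>0 < N\<close> by (simp add: R_fun_def ln_div algebra_simps)
qed (simp add: R_fun_def)

locale killing = prob_space M for M :: "'a measure" +
  fixes r :: real and p :: "real \<Rightarrow> 'a \<Rightarrow> real"
  assumes r_pos: "0 < r"
    and p_measurable: "(\<lambda>z. p (max 0 (snd z)) (fst z)) \<in> borel_measurable (M \<Otimes>\<^sub>M lborel)"
    and p_nonneg: "\<And>t \<omega>. 0 \<le> t \<Longrightarrow> \<omega> \<in> space M \<Longrightarrow> 0 \<le> p t \<omega>"
begin

definition rate :: "'a \<times> real \<Rightarrow> real" where
  "rate z = p (max 0 (snd z)) (fst z)"

text \<open>The discounted occupation measure: the law of chance and time spent before an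
  exponential clock of rate \<open>r + p\<close> rings. Its \<open>mass\<close> is the expected
  lifetime, and \<open>intensity\<close> the expected discounted amount of control.\<close>

definition occ :: "('a \<times> real) measure" where
  "occ = density (M \<Otimes>\<^sub>M lborel) (\<lambda>z. ennreal (discount r p (snd z) (fst z)) * indicator {0..} (snd z))"

definition mass :: real where "mass = measure occ (space occ)"

definition intensity :: real where "intensity = (\<integral>z. rate z \<partial>occ)"

lemma rate_measurable[measurable]: "rate \<in> borel_measurable (M \<Otimes>\<^sub>M lborel)"
  using p_measurable by (simp add: rate_def[abs_def])

lemma sets_occ[measurable_cong]: "sets occ = sets (M \<Otimes>\<^sub>M lborel)"
  by (simp add: occ_def)

lemma rate_nonneg: "z \<in> space occ \<Longrightarrow> 0 \<le> rate z"
  by (auto simp: occ_def rate_def space_pair_measure intro!: p_nonneg)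

lemma discount_nonneg: "0 \<le> discount r p t \<omega>"
  by (simp add: discount_def Let_def)

lemma exponent_eq:
  "(\<integral>\<^sup>+ s\<in>{0..t}. ennreal (r + p s \<omega>) \<partial>lborel)
     = (\<integral>\<^sup>+ s. (if 0 \<le> s \<and> s \<le> t then ennreal (r + rate (\<omega>, s)) else 0) \<partial>lborel)"
  by (intro nn_integral_cong) (auto simp: rate_def split: split_indicator)

lemma discount_measurable[measurable]:
  "(\<lambda>z. discount r p (snd z) (fst z)) \<in> borel_measurable (M \<Otimes>\<^sub>M lborel)"
  unfolding discount_def exponent_eq Let_def by measurable

lemma nn_integral_occ:
  assumes [measurable]: "u \<in> borel_measurable (M \<Otimes>\<^sub>M lborel)"
  shows "(\<integral>\<^sup>+ z. u z \<partial>occ)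
    = (\<integral>\<^sup>+ \<omega>. (\<integral>\<^sup>+ t\<in>{0..}. ennreal (discount r p t \<omega>) * u (\<omega>, t) \<partial>lborel) \<partial>M)"
  unfolding occ_def
  by (subst nn_integral_density, simp, simp, subst lborel.nn_integral_fst[symmetric])
    (auto simp: ac_simps)

text \<open>The pathwise killing mass is at most 1. Since \<open>r\<close> is positive, this makes
  \<open>occ\<close> finite and \<open>rate\<close> integrable for every control.\<close>

lemma nn_integral_rate_le: "(\<integral>\<^sup>+ z. ennreal (r + rate z) \<partial>occ) \<le> 1"
proof -
  have "(\<integral>\<^sup>+ z. ennreal (r + rate z) \<partial>occ)
    = (\<integral>\<^sup>+ \<omega>. (\<integral>\<^sup>+ t\<in>{0..}. ennreal (discount r p t \<omega>) * ennreal (r + rate (\<omega>, t)) \<partial>lborel) \<partial>M)"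
    by (rule nn_integral_occ) simp
  also have "\<dots> \<le> (\<integral>\<^sup>+ \<omega>. 1 \<partial>M)"
  proof (rule nn_integral_mono)
    fix \<omega> assume [measurable]: "\<omega> \<in> space M"
    define u where "u t = ennreal (r + rate (\<omega>, t))" for t
    have [measurable]: "u \<in> borel_measurable lborel" unfolding u_def[abs_def] by measurable
    have "(\<integral>\<^sup>+ s\<in>{0..t}. ennreal (r + p s \<omega>) \<partial>lborel) = (\<integral>\<^sup>+ s\<in>{0..t}. u s \<partial>lborel)" for t
      by (intro nn_integral_cong) (auto simp: rate_def u_def split: split_indicator)
    then have "ennreal (discount r p t \<omega>) = (if (\<integral>\<^sup>+ s\<in>{0..t}. u s \<partial>lborel) = \<infinity> then 0
        else ennreal (exp (- enn2real (\<integral>\<^sup>+ s\<in>{0..t}. u s \<partial>lborel))))" for t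
      by (simp add: discount_def Let_def)
    then show "(\<integral>\<^sup>+ t\<in>{0..}. ennreal (discount r p t \<omega>) * ennreal (r + rate (\<omega>, t)) \<partial>lborel) \<le> 1"
      using nn_integral_rate_discount_le[of u] by (simp add: u_def mult.commute)
  qed
  also have "\<dots> = 1" by (simp add: emeasure_space_1)
  finally show ?thesis .
qed

lemma finite_occ: "finite_measure occ"
proof
  have "ennreal r * emeasure occ (space occ) = (\<integral>\<^sup>+ z. ennreal r \<partial>occ)" by simp
  also have "\<dots> \<le> (\<integral>\<^sup>+ z. ennreal (r + rate z) \<partial>occ)"
    by (intro nn_integral_mono ennreal_leI) (simp add: rate_nonneg)
  also have "\<dots> \<le> 1" by (rule nn_integral_rate_le)
  finally show "emeasure occ (space occ) \<noteq> \<infinity>"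
    using r_pos by (auto simp: ennreal_mult_top top_unique)
qed

lemma integrable_rate: "integrable occ rate"
proof (rule integrableI_nonneg)
  show "AE z in occ. 0 \<le> rate z" using rate_nonneg by auto
  have "(\<integral>\<^sup>+ z. ennreal (rate z) \<partial>occ) \<le> (\<integral>\<^sup>+ z. ennreal (r + rate z) \<partial>occ)"
    using r_pos by (intro nn_integral_mono ennreal_leI) simp
  also have "\<dots> \<le> 1" by (rule nn_integral_rate_le)
  finally show "(\<integral>\<^sup>+ z. ennreal (rate z) \<partial>occ) < \<infinity>" by (simp add: order_le_less_trans)
qed measurable

text \<open>The trade-off behind the contraction: an intensity near 1 forces the mass to be near
  0.\<close>

lemma mass_intensity: "r * mass + intensity \<le> 1"
proof -
  interpret occ: finite_measure occ by (rule finite_occ)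
  have "ennreal (\<integral>z. r + rate z \<partial>occ) \<le> 1"
    using nn_integral_rate_le integrable_rate rate_nonneg r_pos
    by (subst nn_integral_eq_integral[symmetric]) (auto simp: add_nonneg_nonneg)
  then have "(\<integral>z. r + rate z \<partial>occ) \<le> 1" by (simp add: ennreal_le_1)
  then show ?thesis using integrable_rate by (simp add: mass_def intensity_def mult.commute)
qed

lemma mass_nonneg: "0 \<le> mass" by (simp add: mass_def)

lemma intensity_le_1: "intensity \<le> 1"
  using mass_intensity mass_nonneg r_pos mult_nonneg_nonneg[of r mass] by linarith

end

locale killing_cost = killing M r p for M :: "'a measure" and r p +
  fixes X :: "real \<Rightarrow> real \<Rightarrow> 'a \<Rightarrow> real" and f :: "real \<Rightarrow> real" and lam x :: real
  assumes X_measurable: "(\<lambda>z. X x (max 0 (snd z)) (fst z)) \<in> borel_measurable (M \<Otimes>\<^sub>M lborel)"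
    and f_measurable[measurable]: "f \<in> borel_measurable borel"
    and f_nonneg: "\<And>y. 0 \<le> f y"
    and lam_pos: "0 < lam"
begin

definition running :: "(real \<Rightarrow> real) \<Rightarrow> 'a \<times> real \<Rightarrow> real" where
  "running phi z = f (X x (max 0 (snd z)) (fst z)) - lam * R_fun (rate z)
     + rate z * phi (X x (max 0 (snd z)) (fst z))"

lemma running_measurable[measurable]:
  assumes [measurable]: "phi \<in> borel_measurable borel"
  shows "running phi \<in> borel_measurable (M \<Otimes>\<^sub>M lborel)"
proof -
  note X_measurable[measurable]
  have [measurable]: "R_fun \<in> borel_measurable borel" unfolding R_fun_def[abs_def] by measurable
  show ?thesis unfolding running_def[abs_def] by measurable
qed

lemma cost_eq:
  assumes [measurable]: "phi \<in> borel_measurable borel"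
  shows "cost M X f r lam phi x p = ext_integral occ (running phi)"
proof -
  \<comment> \<open>The sign \<open>s\<close>, later 1 and -1, treats the positive and the negative
    part at once.\<close>
  have "(\<integral>\<^sup>+ \<omega>. (\<integral>\<^sup>+ t\<in>{0..}. ennreal (s * (discount r p t \<omega> *
            (f (X x t \<omega>) - lam * R_fun (p t \<omega>) + p t \<omega> * phi (X x t \<omega>)))) \<partial>lborel) \<partial>M)
     = (\<integral>\<^sup>+ z. ennreal (s * running phi z) \<partial>occ)" for s
    by (subst nn_integral_occ, measurable)
      (auto intro!: nn_integral_cong simp: running_def rate_def discount_nonneg ennreal_mult'[symmetric]
        mult.left_commute split: split_indicator)
  from this[of 1] this[of "-1"] show ?thesis
    by (simp add: cost_def ext_integral_def Let_def)
qed

text \<open>By the tangent at 1 the running cost is at least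
  \<open>- lam - \<bar>c\<bar> * rate\<close>, which is integrable. Costs are therefore never a
  difference of two infinities.\<close>

lemma nn_integral_neg_running:
  assumes [measurable]: "phi \<in> borel_measurable borel" and lower: "\<And>y. - c \<le> phi y"
  shows "(\<integral>\<^sup>+ z. ennreal (- running phi z) \<partial>occ) < \<infinity>"
proof -
  interpret occ: finite_measure occ by (rule finite_occ)
  have "(\<integral>\<^sup>+ z. ennreal (- running phi z) \<partial>occ) \<le> (\<integral>\<^sup>+ z. ennreal (lam + \<bar>c\<bar> * rate z) \<partial>occ)"
  proof (intro nn_integral_mono ennreal_leI)
    fix z assume z: "z \<in> space occ"
    have "lam * R_fun (rate z) \<le> lam * 1"
      using R_fun_le[of 1 "rate z"] rate_nonneg[OF z] lam_pos by (intro mult_left_mono) auto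
    moreover have "rate z * - \<bar>c\<bar> \<le> rate z * phi (X x (max 0 (snd z)) (fst z))"
      using lower[of "X x (max 0 (snd z)) (fst z)"] rate_nonneg[OF z] by (intro mult_left_mono) auto
    ultimately show "- running phi z \<le> lam + \<bar>c\<bar> * rate z"
      unfolding running_def using f_nonneg[of "X x (max 0 (snd z)) (fst z)"] by (simp add: mult.commute)
  qed
  also have "\<dots> < \<infinity>"
    using integrable_rate by (intro integrable_nn_integral_finite) simp
  finally show ?thesis .
qed

text \<open>The function \<open>phi\<close> enters the running cost multiplied by the rate, so
  raising it by \<open>s\<close> adds \<open>s\<close> times the integral of the rate.\<close>

lemma cost_le_add:
  assumes phi[measurable]: "phi1 \<in> borel_measurable borel" "phi2 \<in> borel_measurable borel"
    and lower: "\<And>y. - c \<le> phi1 y" "\<And>y. - c \<le> phi2 y"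
    and le: "\<And>y. phi1 y \<le> phi2 y + s"
  shows "cost M X f r lam phi1 x p \<le> cost M X f r lam phi2 x p + ereal (s * intensity)"
proof -
  have "ext_integral occ (running phi1) \<le> ext_integral occ (running phi2) + ereal (\<integral>z. s * rate z \<partial>occ)"
  proof (rule ext_integral_le_add)
    show "running phi1 z \<le> running phi2 z + s * rate z" if "z \<in> space occ" for z
      using mult_left_mono[OF le rate_nonneg[OF that], of "X x (max 0 (snd z)) (fst z)"]
      by (simp add: running_def algebra_simps)
  qed (use integrable_rate lower in \<open>auto intro!: nn_integral_neg_running[where c = c] simp del: infinity_ennreal_def\<close>)
  then show ?thesis by (simp add: cost_eq intensity_def)
qed

text \<open>The tangent at \<open>N\<close> bounds the running cost below by
  \<open>(lam * ln N - c) * rate - lam * N\<close>. With \<open>N\<close> large, a control of high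
  intensity and small mass must be expensive.\<close>

lemma cost_ge:
  assumes phi[measurable]: "phi \<in> borel_measurable borel"
    and lower: "\<And>y. - c \<le> phi y" and N: "0 < N"
  shows "ereal ((lam * ln N - c) * intensity) \<le> cost M X f r lam phi x p + ereal (lam * N * mass)"
proof -
  interpret occ: finite_measure occ by (rule finite_occ)
  have int: "integrable occ (\<lambda>z. (lam * ln N - c) * rate z)" using integrable_rate by simp
  have "ext_integral occ (\<lambda>z. (lam * ln N - c) * rate z)
      \<le> ext_integral occ (running phi) + ereal (\<integral>z. lam * N \<partial>occ)"
  proof (rule ext_integral_le_add)
    show "(lam * ln N - c) * rate z \<le> running phi z + lam * N" if z: "z \<in> space occ" for z
    proof -
      have "lam * R_fun (rate z) \<le> lam * (N - rate z * ln N)"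
        using R_fun_le[OF N rate_nonneg[OF z]] lam_pos by (intro mult_left_mono) auto
      moreover have "rate z * - c \<le> rate z * phi (X x (max 0 (snd z)) (fst z))"
        using lower[of "X x (max 0 (snd z)) (fst z)"] rate_nonneg[OF z] by (intro mult_left_mono) auto
      ultimately show ?thesis
        unfolding running_def using f_nonneg[of "X x (max 0 (snd z)) (fst z)"] by (simp add: algebra_simps)
    qed
    show "(\<integral>\<^sup>+ z. ennreal (- ((lam * ln N - c) * rate z)) \<partial>occ) < \<infinity>"
      using integrable_nn_integral_finite[OF integrable_minus[OF int]] .
  qed (use lower in \<open>auto intro!: nn_integral_neg_running[where c = c] simp del: infinity_ennreal_def\<close>)
  then show ?thesis
    using int by (simp add: cost_eq ext_integral_integrable intensity_def mass_def mult_ac)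
qed

end

section \<open>The optimal killing operator\<close>

locale entropic_killing = prob_space M for M :: "'a measure" +
  fixes F :: "real \<Rightarrow> 'a measure" and X :: "real \<Rightarrow> real \<Rightarrow> 'a \<Rightarrow> real"
    and f :: "real \<Rightarrow> real" and r lam :: real
  assumes filtration: "usual_filtration M F"
    and X_measurable: "\<And>x t. 0 \<le> t \<Longrightarrow> X x t \<in> borel_measurable M"
    and X_continuous: "\<And>x \<omega>. \<omega> \<in> space M \<Longrightarrow> continuous_on {0..} (\<lambda>t. X x t \<omega>)"
    and f_measurable: "f \<in> borel_measurable borel"
    and f_nonneg: "\<And>y. 0 \<le> f y"
    and r_pos: "0 < r" and lam_pos: "0 < lam"
begin

abbreviation controls :: "(real \<Rightarrow> 'a \<Rightarrow> real) set" where
  "controls \<equiv> {p. progressive M F p \<and> (\<forall>t\<ge>0. \<forall>\<omega>\<in>space M. 0 \<le> p t \<omega>)}"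

lemma killing_cost_control:
  assumes "p \<in> controls"
  shows "killing_cost M r p X f lam x"
proof
  show "0 < r" "0 < lam" by (fact r_pos lam_pos)+
  show "(\<lambda>z. p (max 0 (snd z)) (fst z)) \<in> borel_measurable (M \<Otimes>\<^sub>M lborel)"
    using assms by (intro measurable_progressive[OF filtration]) simp
  show "(\<lambda>z. X x (max 0 (snd z)) (fst z)) \<in> borel_measurable (M \<Otimes>\<^sub>M lborel)"
    by (rule measurable_continuous_process) (fact X_measurable X_continuous)+
qed (use assms f_measurable f_nonneg in auto)

lemma T_op_le_cost: "p \<in> controls \<Longrightarrow> T_op M F X f r lam phi x \<le> cost M X f r lam phi x p"
  unfolding T_op_def by (rule INF_lower)

lemma T_op_le_add:
  assumes phi: "phi1 \<in> borel_measurable borel" "phi2 \<in> borel_measurable borel"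
    and lower: "\<And>y. - c \<le> phi1 y" "\<And>y. - c \<le> phi2 y"
    and le: "\<And>y. phi1 y \<le> phi2 y + s" and s: "0 \<le> s"
  shows "T_op M F X f r lam phi1 x \<le> T_op M F X f r lam phi2 x + ereal s"
proof -
  have "T_op M F X f r lam phi1 x - ereal s \<le> cost M X f r lam phi2 x p" if p: "p \<in> controls" for p
  proof -
    interpret killing_cost M r p X f lam x using p by (rule killing_cost_control)
    have "T_op M F X f r lam phi1 x \<le> cost M X f r lam phi1 x p" using p by (rule T_op_le_cost)
    also have "\<dots> \<le> cost M X f r lam phi2 x p + ereal (s * intensity)"
      using phi lower le by (rule cost_le_add)
    \<comment> \<open>This is where \<open>0 \<le> s\<close> enters: the intensity is only known to
      be at most 1.\<close>
    also have "\<dots> \<le> cost M X f r lam phi2 x p + ereal s"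
      using intensity_le_1 s by (intro add_left_mono) (simp add: mult_left_le)
    finally show ?thesis by (simp add: ereal_minus_le)
  qed
  then have "T_op M F X f r lam phi1 x - ereal s \<le> T_op M F X f r lam phi2 x"
    unfolding T_op_def[of _ _ _ _ _ _ phi2] by (rule INF_greatest)
  then show ?thesis by (simp add: ereal_minus_le)
qed

text \<open>Near-optimal controls stay away from killing instantaneously, because high rates
  are penalised by the entropy: this makes the operator contract locally uniformly.\<close>
lemma T_op_contract:
  assumes phi2: "phi2 \<in> borel_measurable borel" and lower2: "\<And>y. - c \<le> phi2 y"
  obtains \<kappa> where "\<kappa> < 1"
    "\<And>phi1 s x v. \<lbrakk>phi1 \<in> borel_measurable borel; \<And>y. - c \<le> phi1 y; 0 \<le> s;
        \<And>y. phi1 y \<le> phi2 y + s; T_op M F X f r lam phi2 x = ereal v; v \<le> C\<rbrakk>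
      \<Longrightarrow> T_op M F X f r lam phi1 x \<le> ereal (v + \<kappa> * s)"
proof -
  \<comment> \<open>The choice of \<open>N\<close> makes \<open>cost_ge\<close> charge exactly
    \<open>B\<close> per unit of intensity. As \<open>B\<close> exceeds
    \<open>\<bar>C\<bar> + 1\<close> by 1, the quotient \<open>\<kappa>\<close> is below 1, and it
    depends on neither the point nor the control.\<close>
  define B where "B = \<bar>C\<bar> + 2"
  define N where "N = exp ((B + c) / lam)"
  define \<kappa> where "\<kappa> = (\<bar>C\<bar> + 1 + lam * N / r) / (B + lam * N / r)"
  have N: "0 < N" "lam * ln N - c = B" using lam_pos by (simp_all add: N_def)
  have den: "0 < B + lam * N / r" using lam_pos r_pos N by (simp add: B_def add_pos_pos)
  have "\<kappa> < 1" using den by (simp add: \<kappa>_def B_def)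
  moreover have "T_op M F X f r lam phi1 x \<le> ereal (v + \<kappa> * s)"
    if phi1: "phi1 \<in> borel_measurable borel" "\<And>y. - c \<le> phi1 y" and s: "0 \<le> s"
      and le: "\<And>y. phi1 y \<le> phi2 y + s"
      and v: "T_op M F X f r lam phi2 x = ereal v" "v \<le> C" for phi1 s x v
  proof (rule ereal_le_epsilon2)
    fix e :: real assume "0 < e"
    \<comment> \<open>The cap at 1 keeps near-optimal costs below \<open>\<bar>C\<bar> + 1\<close>,
      so that \<open>\<kappa>\<close> does not depend on \<open>e\<close>.\<close>
    define \<epsilon> where "\<epsilon> = min e 1"
    have \<epsilon>: "0 < \<epsilon>" "\<epsilon> \<le> e" "\<epsilon> \<le> 1" using \<open>0 < e\<close> by (auto simp: \<epsilon>_def)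
    have "T_op M F X f r lam phi2 x < ereal (v + \<epsilon>)" using \<epsilon> v by simp
    then obtain p where p: "p \<in> controls" and near: "cost M X f r lam phi2 x p < ereal (v + \<epsilon>)"
      unfolding T_op_def INF_less_iff by blast
    interpret killing_cost M r p X f lam x using p by (rule killing_cost_control)
    have "ereal (B * intensity) \<le> cost M X f r lam phi2 x p + ereal (lam * N * mass)"
      using cost_ge[OF phi2 lower2 N(1)] N(2) by simp
    also have "\<dots> \<le> ereal (v + \<epsilon>) + ereal (lam * N * mass)"
      using near by (intro add_right_mono) simp
    finally have "B * intensity \<le> v + \<epsilon> + lam * N * mass" by simp
    \<comment> \<open>Trading mass for intensity leaves a linear inequality in
      \<open>intensity\<close> alone, whose solution is the bound \<open>\<kappa>\<close>.\<close>
    moreover have "lam * N * mass \<le> lam * N * ((1 - intensity) / r)"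
      using mass_intensity r_pos lam_pos N by (intro mult_left_mono) (auto simp: field_simps)
    ultimately have "B * intensity \<le> \<bar>C\<bar> + 1 + lam * N * ((1 - intensity) / r)"
      using v(2) \<epsilon> by linarith
    then have "(B + lam * N / r) * intensity \<le> \<bar>C\<bar> + 1 + lam * N / r"
      by (simp add: algebra_simps diff_divide_distrib)
    then have "intensity \<le> \<kappa>" using den by (simp add: \<kappa>_def field_simps)
    then have int: "s * intensity \<le> \<kappa> * s" using s by (subst mult.commute) (rule mult_right_mono)
    have "T_op M F X f r lam phi1 x \<le> cost M X f r lam phi1 x p" using p by (rule T_op_le_cost)
    also have "\<dots> \<le> cost M X f r lam phi2 x p + ereal (s * intensity)"
      using phi1(1) phi2 phi1(2) lower2 le by (rule cost_le_add)
    also have "\<dots> \<le> ereal (v + \<epsilon>) + ereal (\<kappa> * s)"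
      using near int by (intro add_mono) auto
    also have "\<dots> \<le> ereal (v + \<kappa> * s) + ereal e" using \<epsilon> by simp
    finally show "T_op M F X f r lam phi1 x \<le> ereal (v + \<kappa> * s) + ereal e" .
  qed
  ultimately show thesis by (rule that)
qed

end

section \<open>Gaussian estimates\<close>

lemma prob_space_gauss_shift: "prob_space (gauss_shift x)"
  unfolding gauss_shift_def by (rule prob_space_normal_density) simp

lemma sets_gauss_shift[simp, measurable_cong]: "sets (gauss_shift x) = sets borel"
  by (simp add: gauss_shift_def)

lemma space_gauss_shift[simp]: "space (gauss_shift x) = UNIV"
  by (simp add: gauss_shift_def)

text \<open>The post-impulse position \<open>z = x + \<xi>\<close> is standard normal for every
  \<open>x\<close>, so all Gibbs integrals can share one reference measure.\<close>

lemma integral_gauss_shift: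
  fixes g :: "real \<Rightarrow> real"
  assumes [measurable]: "g \<in> borel_measurable borel"
  shows "(\<integral>\<xi>. g \<xi> \<partial>gauss_shift x) = (\<integral>z. g (z - x) \<partial>gauss_shift 0)"
proof -
  have "(\<integral>\<xi>. g \<xi> \<partial>gauss_shift x) = (\<integral>\<xi>. normal_density (- x) 1 \<xi> * g \<xi> \<partial>lborel)"
    unfolding gauss_shift_def by (subst integral_density) auto
  also have "\<dots> = (\<integral>z. normal_density (- x) 1 (- x + 1 * z) * g (- x + 1 * z) \<partial>lborel)"
    using lborel_integral_real_affine[of 1 "\<lambda>\<xi>. normal_density (- x) 1 \<xi> * g \<xi>" "- x"] by simp
  also have "\<dots> = (\<integral>z. normal_density 0 1 z * g (z - x) \<partial>lborel)"
    by (simp add: normal_density_def)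
  also have "\<dots> = (\<integral>z. g (z - x) \<partial>gauss_shift 0)"
    unfolding gauss_shift_def by (subst integral_density) auto
  finally show ?thesis .
qed

lemma integrable_gauss_exp_abs: "integrable (gauss_shift 0) (\<lambda>z. exp (a * \<bar>z\<bar>))"
proof -
  have "integrable lborel (\<lambda>z. normal_density 0 1 z * exp (a * \<bar>z\<bar>))"
  proof (rule Bochner_Integration.integrable_bound)
    show "integrable lborel (\<lambda>z. sqrt 2 * exp (a\<^sup>2) * normal_density 0 (sqrt 2) z)" by simp
    show "AE z in lborel. norm (normal_density 0 1 z * exp (a * \<bar>z\<bar>))
        \<le> norm (sqrt 2 * exp (a\<^sup>2) * normal_density 0 (sqrt 2) z)"
    proof (rule AE_I2)
      fix z :: real
      \<comment> \<open>Completing this square costs half of the Gaussian exponent; what remains is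
        a multiple of the normal density of variance 2.\<close>
      have "0 \<le> (a - \<bar>z\<bar> / 2)\<^sup>2" by simp
      also have "\<dots> = a\<^sup>2 - a * \<bar>z\<bar> + z\<^sup>2 / 4" by (simp add: power2_diff power_divide)
      finally have "exp (- z\<^sup>2 / 2 + a * \<bar>z\<bar>) \<le> exp (a\<^sup>2 - z\<^sup>2 / 4)" by simp
      then have "(1 / sqrt (2 * pi)) * exp (- z\<^sup>2 / 2 + a * \<bar>z\<bar>) \<le> (1 / sqrt (2 * pi)) * exp (a\<^sup>2 - z\<^sup>2 / 4)"
        by (intro mult_left_mono) auto
      also have "\<dots> = sqrt 2 * exp (a\<^sup>2) * normal_density 0 (sqrt 2) z"
      proof -
        have "exp (a\<^sup>2 - z\<^sup>2 / 4) = exp (a\<^sup>2) * exp (- z\<^sup>2 / 4)" by (simp add: exp_add[symmetric])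
        moreover have "normal_density 0 (sqrt 2) z = 1 / (sqrt 2 * sqrt (2 * pi)) * exp (- z\<^sup>2 / 4)"
          by (simp add: normal_density_def real_sqrt_mult[symmetric] mult.commute)
        ultimately show ?thesis by simp
      qed
      also have "(1 / sqrt (2 * pi)) * exp (- z\<^sup>2 / 2 + a * \<bar>z\<bar>) = normal_density 0 1 z * exp (a * \<bar>z\<bar>)"
        unfolding exp_add by (simp add: normal_density_def)
      finally show "norm (normal_density 0 1 z * exp (a * \<bar>z\<bar>))
        \<le> norm (sqrt 2 * exp (a\<^sup>2) * normal_density 0 (sqrt 2) z)" by simp
    qed
  qed simp
  then show ?thesis
    unfolding gauss_shift_def by (subst integrable_density) auto
qed

lemma measure_gauss_unit_interval_pos: "0 < measure (gauss_shift 0) {-1..1}"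
proof -
  interpret prob_space "gauss_shift 0" by (rule prob_space_gauss_shift)
  have "0 < ennreal (normal_density 0 1 1) * emeasure lborel {-1..1::real}"
    by (simp add: ennreal_zero_less_mult_iff normal_density_pos)
  also have "\<dots> = (\<integral>\<^sup>+ z. ennreal (normal_density 0 1 1) * indicator {-1..1::real} z \<partial>lborel)"
    by (rule nn_integral_cmult_indicator[symmetric]) simp
  also have "\<dots> \<le> (\<integral>\<^sup>+ z. ennreal (normal_density 0 1 z) * indicator {-1..1} z \<partial>lborel)"
  proof (intro nn_integral_mono)
    fix z :: real
    have "normal_density 0 1 1 \<le> normal_density 0 1 z" if "\<bar>z\<bar> \<le> 1"
      using power_mono[OF that, of 2] by (simp add: normal_density_def divide_right_mono)
    then show "ennreal (normal_density 0 1 1) * indicator {-1..1} z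
        \<le> ennreal (normal_density 0 1 z) * indicator {-1..1} z"
      by (auto split: split_indicator intro: ennreal_leI)
  qed
  also have "\<dots> = emeasure (gauss_shift 0) {-1..1}"
    by (simp add: gauss_shift_def emeasure_density)
  finally show ?thesis by (simp add: emeasure_eq_measure)
qed

section \<open>The soft impulse operator\<close>

definition admissible :: "(real \<Rightarrow> real) \<Rightarrow> bool" where
  "admissible \<phi> \<longleftrightarrow> continuous_on UNIV \<phi> \<and> bdd_below (range \<phi>)"

lemma admissibleE:
  assumes "admissible \<phi>"
  obtains c where "\<And>z. - c \<le> \<phi> z"
  using assms by (metis admissible_def bdd_below.unfold minus_minus rangeI)

lemma admissible_measurable[measurable_dest]: "admissible \<phi> \<Longrightarrow> \<phi> \<in> borel_measurable borel"
  by (simp add: admissible_def borel_measurable_continuous_onI)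

locale soft_impulse =
  fixes l :: "real \<Rightarrow> real" and lam K Ll :: real
  assumes l_lipschitz: "Ll-lipschitz_on UNIV l" and l_ge: "\<And>\<xi>. K \<le> l \<xi>" and lam_pos: "0 < lam"
begin

text \<open>The Gibbs weight as a function of the post-impulse position \<open>z\<close>, so that
  \<open>x\<close> enters only through the impulse cost; \<open>Z\<close> is the partition
  function.\<close>

definition weight :: "(real \<Rightarrow> real) \<Rightarrow> real \<Rightarrow> real \<Rightarrow> real" where
  "weight \<phi> x z = exp (- (\<phi> z + l (z - x)) / lam)"

definition Z :: "(real \<Rightarrow> real) \<Rightarrow> real \<Rightarrow> real" where
  "Z \<phi> x = (\<integral>z. weight \<phi> x z \<partial>gauss_shift 0)"

definition m :: "(real \<Rightarrow> real) \<Rightarrow> real \<Rightarrow> real" where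
  "m \<phi> x = real_of_ereal (M_op l lam \<phi> x)"

lemma l_measurable[measurable]: "l \<in> borel_measurable borel"
  using l_lipschitz lipschitz_on_continuous_on borel_measurable_continuous_onI by blast

lemma l_diff: "l u \<le> l v + Ll * \<bar>u - v\<bar>"
  using lipschitz_onD[OF l_lipschitz, of u v] by (auto simp: dist_real_def)

lemma Ll_nonneg: "0 \<le> Ll" using l_lipschitz by (rule lipschitz_on_nonneg)

lemma weight_measurable[measurable]:
  assumes [measurable]: "\<phi> \<in> borel_measurable borel"
  shows "weight \<phi> x \<in> borel_measurable borel"
  unfolding weight_def[abs_def] by measurable

lemma weight_pos: "0 < weight \<phi> x z" by (simp add: weight_def)

lemma weight_le:
  assumes "\<phi> z + l (z - x) \<ge> a"
  shows "weight \<phi> x z \<le> exp (- a / lam)"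
  using divide_right_mono[of "- (\<phi> z + l (z - x))" "- a" lam] assms lam_pos by (simp add: weight_def)

lemma weight_integrable:
  assumes "admissible \<phi>"
  shows "integrable (gauss_shift 0) (weight \<phi> x)"
proof -
  interpret prob_space "gauss_shift 0" by (rule prob_space_gauss_shift)
  obtain c where c: "\<And>z. - c \<le> \<phi> z" using assms by (rule admissibleE) blast
  have [measurable]: "\<phi> \<in> borel_measurable borel" using assms by (rule admissible_measurable)
  have "weight \<phi> x z \<le> exp (- (- c + K) / lam)" for z by (intro weight_le add_mono c l_ge)
  then show ?thesis
    using weight_pos[of \<phi> x]
    by (intro integrable_const_bound[of _ "exp (- (- c + K) / lam)"]) (auto simp: less_imp_le)
qed

lemma weight_core_integrable:
  assumes "admissible \<phi>"
  shows "integrable (gauss_shift 0) (\<lambda>z. indicator {-1..1} z * weight \<phi> x z)"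
  using integrable_mult_indicator[OF _ weight_integrable[OF assms], of "{-1..1}"] by simp

text \<open>On \<open>{-1..1}\<close> the function \<open>\<phi>\<close> is bounded by compactness,
  and \<open>l (z - x)\<close> exceeds \<open>l (- x)\<close> by at most \<open>Ll\<close>. Together
  with \<open>Z_upper\<close> this fixes the order of \<open>Z \<phi> x\<close> as
  \<open>exp (- l (- x) / lam)\<close>, uniformly in \<open>x\<close>.\<close>

lemma Z_lower_core:
  assumes "admissible \<phi>"
  obtains c1 where "0 < c1"
    "\<And>x. c1 * exp (- l (- x) / lam) \<le> (\<integral>z. indicator {-1..1} z * weight \<phi> x z \<partial>gauss_shift 0)"
proof -
  interpret prob_space "gauss_shift 0" by (rule prob_space_gauss_shift)
  have "bounded (\<phi> ` {-1..1})"
    using assms by (intro compact_imp_bounded compact_continuous_image) (auto simp: admissible_def intro: continuous_on_subset)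
  then obtain B where B: "\<And>z. z \<in> {-1..1} \<Longrightarrow> \<phi> z \<le> B"
    unfolding bounded_real by (metis abs_le_D1 image_eqI)
  have meas[measurable]: "\<phi> \<in> borel_measurable borel" using assms by (rule admissible_measurable)
  define c1 where "c1 = exp (- (B + Ll) / lam) * measure (gauss_shift 0) {-1..1}"
  have "0 < c1" using measure_gauss_unit_interval_pos by (simp add: c1_def)
  moreover have "c1 * exp (- l (- x) / lam) \<le> (\<integral>z. indicator {-1..1} z * weight \<phi> x z \<partial>gauss_shift 0)" for x
  proof -
    have "c1 * exp (- l (- x) / lam)
        = (\<integral>z. indicator {-1..1} z * (exp (- (B + Ll) / lam) * exp (- l (- x) / lam)) \<partial>gauss_shift 0)"
      by (simp add: c1_def)
    also have "\<dots> \<le> (\<integral>z. indicator {-1..1} z * weight \<phi> x z \<partial>gauss_shift 0)"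
    proof (rule integral_mono)
      show "integrable (gauss_shift 0) (\<lambda>z. indicator {-1..1} z * weight \<phi> x z)"
        by (rule weight_core_integrable[OF assms])
      fix z :: real
      have "weight \<phi> x z \<ge> exp (- (B + Ll) / lam) * exp (- l (- x) / lam)" if z: "z \<in> {-1..1}"
      proof -
        have "Ll * \<bar>z\<bar> \<le> Ll * 1" using z Ll_nonneg by (intro mult_left_mono) auto
        then have "l (z - x) \<le> l (- x) + Ll" using l_diff[of "z - x" "- x"] by simp
        then have "\<phi> z + l (z - x) \<le> B + Ll + l (- x)" using B[OF z] by simp
        then have "- (B + Ll + l (- x)) / lam \<le> - (\<phi> z + l (z - x)) / lam"
          using lam_pos by (intro divide_right_mono) auto
        then show ?thesis
          unfolding weight_def exp_add[symmetric] by (simp add: add_divide_distrib diff_divide_distrib)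
      qed
      then show "indicator {-1..1} z * (exp (- (B + Ll) / lam) * exp (- l (- x) / lam))
          \<le> indicator {-1..1} z * weight \<phi> x z"
        by (auto split: split_indicator)
    qed (simp add: integrable_real_indicator emeasure_eq_measure)
    finally show ?thesis .
  qed
  ultimately show thesis by (rule that)
qed

lemma core_le_Z:
  assumes "admissible \<phi>"
  shows "(\<integral>z. indicator {-1..1} z * weight \<phi> x z \<partial>gauss_shift 0) \<le> Z \<phi> x"
  unfolding Z_def
  by (rule integral_mono)
    (auto simp: weight_core_integrable[OF assms] weight_integrable[OF assms] less_imp_le[OF weight_pos] split: split_indicator)

lemma Z_pos:
  assumes "admissible \<phi>"
  shows "0 < Z \<phi> x"
proof -
  obtain c1 where c1: "0 < c1"
    "\<And>x. c1 * exp (- l (- x) / lam) \<le> (\<integral>z. indicator {-1..1} z * weight \<phi> x z \<partial>gauss_shift 0)"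
    using assms by (rule Z_lower_core) blast
  have "0 < c1 * exp (- l (- x) / lam)" using c1 by simp
  then show ?thesis using c1(2)[of x] core_le_Z[OF assms, of x] by linarith
qed

text \<open>Here \<open>l (z - x) \<ge> l (- x) - Ll * \<bar>z\<bar>\<close>, and the error is
  absorbed by an exponential moment of the Gaussian.\<close>

lemma Z_upper:
  assumes "admissible \<phi>"
  obtains c2 where "0 < c2" "\<And>x. Z \<phi> x \<le> c2 * exp (- l (- x) / lam)"
proof -
  interpret prob_space "gauss_shift 0" by (rule prob_space_gauss_shift)
  obtain c where c: "\<And>z. - c \<le> \<phi> z" using assms by (rule admissibleE) blast
  define c2 where "c2 = exp (c / lam) * (\<integral>z. exp (Ll / lam * \<bar>z\<bar>) \<partial>gauss_shift 0)"
  have "1 \<le> (\<integral>z. exp (Ll / lam * \<bar>z\<bar>) \<partial>gauss_shift 0)"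
  proof -
    have "(\<integral>z. 1 \<partial>gauss_shift 0) \<le> (\<integral>z. exp (Ll / lam * \<bar>z\<bar>) \<partial>gauss_shift 0)"
      using Ll_nonneg lam_pos by (intro integral_mono integrable_gauss_exp_abs) auto
    then show ?thesis by (simp add: prob_space[simplified])
  qed
  then have "0 < c2" by (simp add: c2_def)
  moreover have "Z \<phi> x \<le> c2 * exp (- l (- x) / lam)" for x
  proof -
    have "Z \<phi> x \<le> (\<integral>z. exp (c / lam) * exp (- l (- x) / lam) * exp (Ll / lam * \<bar>z\<bar>) \<partial>gauss_shift 0)"
      unfolding Z_def
    proof (intro integral_mono weight_integrable[OF assms])
      fix z
      have "- c + (l (- x) - Ll * \<bar>z\<bar>) \<le> \<phi> z + l (z - x)"
        using c[of z] l_diff[of "- x" "z - x"] by simp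
      then have "weight \<phi> x z \<le> exp (- (- c + (l (- x) - Ll * \<bar>z\<bar>)) / lam)" by (rule weight_le)
      then show "weight \<phi> x z \<le> exp (c / lam) * exp (- l (- x) / lam) * exp (Ll / lam * \<bar>z\<bar>)"
        unfolding exp_add[symmetric] by (simp add: add_divide_distrib diff_divide_distrib algebra_simps)
    qed (intro integrable_mult_right integrable_gauss_exp_abs)
    also have "\<dots> = c2 * exp (- l (- x) / lam)" by (simp add: c2_def)
    finally show ?thesis .
  qed
  ultimately show thesis by (rule that)
qed

text \<open>The infimum in \<open>M_op\<close> is a finite free energy, so passing to a real value
  in \<open>m\<close> loses nothing.\<close>

lemma m_eq:
  assumes adm: "admissible \<phi>"
  shows "m \<phi> x = - lam * ln (Z \<phi> x)"
proof -
  obtain c where c: "\<And>z. - c \<le> \<phi> z" using adm by (rule admissibleE) blast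
  have [measurable]: "\<phi> \<in> borel_measurable borel" using adm by (rule admissible_measurable)
  have "M_op l lam \<phi> x
      = ereal (- lam * ln (\<integral>\<xi>. exp (- (\<phi> (x + \<xi>) + l \<xi>) / lam) \<partial>gauss_shift x))"
    unfolding M_op_def sets_gauss_shift[of x, symmetric]
  proof (rule gibbs_variational[OF prob_space_gauss_shift _ _ lam_pos])
    show "- (c - K) \<le> \<phi> (x + \<xi>) + l \<xi>" for \<xi> using c[of "x + \<xi>"] l_ge[of \<xi>] by simp
  qed measurable
  also have "(\<integral>\<xi>. exp (- (\<phi> (x + \<xi>) + l \<xi>) / lam) \<partial>gauss_shift x) = Z \<phi> x"
    by (subst integral_gauss_shift) (simp_all add: Z_def weight_def)
  finally show ?thesis by (simp add: m_def)
qed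

text \<open>Multiplicative comparisons of partition functions become additive comparisons of
  \<open>m\<close>. The points \<open>x\<close> and \<open>y\<close> may differ, which serves the
  Lipschitz estimate.\<close>

lemma m_le:
  assumes adm: "admissible \<phi>1" "admissible \<phi>2"
    and le: "a * Z \<phi>2 y \<le> Z \<phi>1 x" and a: "0 < a"
  shows "m \<phi>1 x \<le> m \<phi>2 y - lam * ln a"
proof -
  have "ln (a * Z \<phi>2 y) \<le> ln (Z \<phi>1 x)"
    using le a Z_pos[OF adm(2), of y] by (intro ln_mono) auto
  then have "ln a + ln (Z \<phi>2 y) \<le> ln (Z \<phi>1 x)" using a Z_pos[OF adm(2), of y] by (simp add: ln_mult)
  then have "lam * (ln a + ln (Z \<phi>2 y)) \<le> lam * ln (Z \<phi>1 x)" using lam_pos by simp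
  then show ?thesis by (simp add: m_eq[OF adm(1)] m_eq[OF adm(2)] algebra_simps)
qed

lemma m_ge:
  assumes adm: "admissible \<phi>" and c: "\<And>z. - c \<le> \<phi> z"
  shows "K - c \<le> m \<phi> x"
proof -
  interpret prob_space "gauss_shift 0" by (rule prob_space_gauss_shift)
  have "Z \<phi> x \<le> (\<integral>z. exp (- (- c + K) / lam) \<partial>gauss_shift 0)"
    unfolding Z_def by (intro integral_mono weight_integrable[OF adm] weight_le add_mono c l_ge) simp
  then have "Z \<phi> x \<le> exp (- (- c + K) / lam)" by (simp add: prob_space[simplified])
  then have "ln (Z \<phi> x) \<le> - (- c + K) / lam"
    using Z_pos[OF adm, of x] by (metis ln_exp ln_mono)
  then show ?thesis using lam_pos by (simp add: m_eq[OF adm] field_simps)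
qed

text \<open>Moving from \<open>y\<close> to \<open>x\<close> changes each weight by a factor of at
  least \<open>exp (- Ll * \<bar>x - y\<bar> / lam)\<close>. So \<open>m \<phi>\<close> inherits the
  Lipschitz constant of \<open>l\<close>, and with it measurability.\<close>

lemma m_diff:
  assumes adm: "admissible \<phi>"
  shows "m \<phi> x \<le> m \<phi> y + Ll * \<bar>x - y\<bar>"
proof -
  define a where "a = exp (- (Ll * \<bar>x - y\<bar>) / lam)"
  have "a * Z \<phi> y = (\<integral>z. a * weight \<phi> y z \<partial>gauss_shift 0)" by (simp add: Z_def)
  also have "\<dots> \<le> Z \<phi> x"
    unfolding Z_def
  proof (intro integral_mono weight_integrable[OF adm] integrable_mult_right)
    fix z
    have "- (Ll * \<bar>x - y\<bar>) + - (\<phi> z + l (z - y)) \<le> - (\<phi> z + l (z - x))"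
      using l_diff[of "z - x" "z - y"] by (simp add: abs_minus_commute)
    then have "(- (Ll * \<bar>x - y\<bar>) + - (\<phi> z + l (z - y))) / lam \<le> - (\<phi> z + l (z - x)) / lam"
      using lam_pos by (intro divide_right_mono) auto
    then show "a * weight \<phi> y z \<le> weight \<phi> x z"
      unfolding a_def weight_def exp_add[symmetric] by (simp add: add_divide_distrib diff_divide_distrib)
  qed
  finally have "m \<phi> x \<le> m \<phi> y - lam * ln a" by (intro m_le adm) (auto simp: a_def)
  then show ?thesis using lam_pos by (simp add: a_def)
qed

lemma m_measurable:
  assumes adm: "admissible \<phi>"
  shows "m \<phi> \<in> borel_measurable borel"
proof -
  have "Ll-lipschitz_on UNIV (m \<phi>)"
  proof (rule lipschitz_onI)
    show "dist (m \<phi> x) (m \<phi> y) \<le> Ll * dist x y" for x y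
      using m_diff[OF adm, of x y] m_diff[OF adm, of y x]
      by (simp add: dist_real_def abs_le_iff abs_minus_commute)
  qed (rule Ll_nonneg)
  then show ?thesis using lipschitz_on_continuous_on borel_measurable_continuous_onI by blast
qed

text \<open>Both partition functions have order \<open>exp (- l (- x) / lam)\<close>. This a priori
  bound makes the supremum of the difference of two fixed points finite although each may be
  unbounded.\<close>

lemma m_diff_bounded:
  assumes adm: "admissible \<phi>1" "admissible \<phi>2"
  obtains S where "\<And>x. m \<phi>1 x \<le> m \<phi>2 x + S"
proof -
  obtain c1 where c1: "0 < c1"
    "\<And>x. c1 * exp (- l (- x) / lam) \<le> (\<integral>z. indicator {-1..1} z * weight \<phi>1 x z \<partial>gauss_shift 0)"
    using adm(1) by (rule Z_lower_core) blast
  obtain c2 where c2: "0 < c2" "\<And>x. Z \<phi>2 x \<le> c2 * exp (- l (- x) / lam)"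
    using adm(2) by (rule Z_upper) blast
  have "m \<phi>1 x \<le> m \<phi>2 x - lam * ln (c1 / c2)" for x
  proof (rule m_le[OF adm])
    have "c1 / c2 * Z \<phi>2 x \<le> c1 / c2 * (c2 * exp (- l (- x) / lam))"
      using c1 c2 by (intro mult_left_mono) auto
    also have "\<dots> = c1 * exp (- l (- x) / lam)" using c2 by simp
    also have "\<dots> \<le> Z \<phi>1 x" using c1(2)[of x] core_le_Z[OF adm(1), of x] by linarith
    finally show "c1 / c2 * Z \<phi>2 x \<le> Z \<phi>1 x" .
  qed (use c1 c2 in simp)
  then show thesis by (intro that[of "- lam * ln (c1 / c2)"]) simp
qed

text \<open>All Gibbs measures of \<open>\<phi>2\<close> charge \<open>{-1..1}\<close> with at least the mass \<open>c1 / c2\<close>, uniformly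
  in \<open>x\<close>, so an improvement on this interval alone improves \<open>m\<close> everywhere.\<close>
lemma m_gain:
  assumes adm: "admissible \<phi>1" "admissible \<phi>2"
    and le: "\<And>z. \<phi>1 z \<le> \<phi>2 z + S" and gain: "\<And>z. z \<in> {-1..1} \<Longrightarrow> \<phi>1 z \<le> \<phi>2 z + S - \<delta>"
    and \<delta>: "0 < \<delta>"
  obtains \<eta> where "0 < \<eta>" "\<And>x. m \<phi>1 x \<le> m \<phi>2 x + (S - \<eta>)"
proof -
  obtain c1 where c1: "0 < c1"
    "\<And>x. c1 * exp (- l (- x) / lam) \<le> (\<integral>z. indicator {-1..1} z * weight \<phi>2 x z \<partial>gauss_shift 0)"
    using adm(2) by (rule Z_lower_core) blast
  obtain c2 where c2: "0 < c2" "\<And>x. Z \<phi>2 x \<le> c2 * exp (- l (- x) / lam)"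
    using adm(2) by (rule Z_upper) blast
  \<comment> \<open>\<open>e\<close> is the relative gain of the weight on \<open>{-1..1}\<close>
    from the extra \<open>\<delta>\<close>. Since the core holds at least the fraction
    \<open>c1 / c2\<close> of \<open>Z \<phi>2 x\<close>, the whole partition function gains the
    factor \<open>k\<close>.\<close>
  define e where "e = exp (\<delta> / lam) - 1"
  have e: "0 < e" using \<delta> lam_pos by (simp add: e_def)
  define k where "k = 1 + e * (c1 / c2)"
  have k: "1 < k" using e c1 c2 by (simp add: k_def)
  have core: "integrable (gauss_shift 0) (\<lambda>z. indicator {-1..1} z * weight \<phi>2 x z)" for x
    by (rule weight_core_integrable[OF adm(2)])
  have bound: "m \<phi>1 x \<le> m \<phi>2 x - lam * ln (exp (- S / lam) * k)" for x
  proof (rule m_le[OF adm])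
    have "c1 / c2 * Z \<phi>2 x \<le> c1 / c2 * (c2 * exp (- l (- x) / lam))"
      using c1 c2 by (intro mult_left_mono) auto
    also have "\<dots> = c1 * exp (- l (- x) / lam)" using c2 by simp
    also have "\<dots> \<le> (\<integral>z. indicator {-1..1} z * weight \<phi>2 x z \<partial>gauss_shift 0)" by (rule c1)
    finally have "e * (c1 / c2 * Z \<phi>2 x) \<le> e * (\<integral>z. indicator {-1..1} z * weight \<phi>2 x z \<partial>gauss_shift 0)"
      using e by (intro mult_left_mono) auto
    then have "k * Z \<phi>2 x \<le> Z \<phi>2 x + e * (\<integral>z. indicator {-1..1} z * weight \<phi>2 x z \<partial>gauss_shift 0)"
      by (simp add: k_def algebra_simps)
    then have "exp (- S / lam) * (k * Z \<phi>2 x) \<le> exp (- S / lam) * (Z \<phi>2 x + e * (\<integral>z. indicator {-1..1} z * weight \<phi>2 x z \<partial>gauss_shift 0))"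
      by (intro mult_left_mono) auto
    also have "\<dots> = (\<integral>z. exp (- S / lam) * (weight \<phi>2 x z + e * (indicator {-1..1} z * weight \<phi>2 x z)) \<partial>gauss_shift 0)"
      using core weight_integrable[OF adm(2)] by (simp add: Z_def)
    also have "\<dots> \<le> Z \<phi>1 x"
      unfolding Z_def
    proof (rule integral_mono)
      fix z
      \<comment> \<open>Applied with \<open>S\<close> off the core and with
        \<open>S - \<delta>\<close> on it.\<close>
      have *: "exp (- s / lam) * weight \<phi>2 x z \<le> weight \<phi>1 x z" if "\<phi>1 z \<le> \<phi>2 z + s" for s
      proof -
        have "(- s + - (\<phi>2 z + l (z - x))) / lam \<le> - (\<phi>1 z + l (z - x)) / lam"
          using that lam_pos by (intro divide_right_mono) auto
        then show ?thesis
          unfolding weight_def exp_add[symmetric] by (simp add: add_divide_distrib diff_divide_distrib)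
      qed
      have "exp (- (S - \<delta>) / lam) = exp (- S / lam) * (1 + e)"
        by (simp add: e_def exp_add[symmetric] diff_divide_distrib add_divide_distrib)
      then show "exp (- S / lam) * (weight \<phi>2 x z + e * (indicator {-1..1} z * weight \<phi>2 x z)) \<le> weight \<phi>1 x z"
        using *[of S] *[of "S - \<delta>"] le[of z] gain[of z]
        by (auto simp: algebra_simps split: split_indicator)
    qed (use core weight_integrable adm in auto)
    finally show "exp (- S / lam) * k * Z \<phi>2 x \<le> Z \<phi>1 x" by (simp add: mult.assoc)
  qed (use k in simp)
  have "lam * ln (exp (- S / lam) * k) = lam * ln k - S"
    using k lam_pos by (simp add: ln_mult algebra_simps)
  then have "m \<phi>1 x \<le> m \<phi>2 x + (S - lam * ln k)" for x using bound[of x] by linarith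
  then show thesis using k lam_pos by (intro that[of "lam * ln k"]) auto
qed

lemma m_mono_add:
  assumes adm: "admissible \<phi>1" "admissible \<phi>2" and le: "\<And>z. \<phi>1 z \<le> \<phi>2 z + S"
  shows "m \<phi>1 x \<le> m \<phi>2 x + S"
proof (rule field_le_epsilon)
  fix e :: real assume "0 < e"
  \<comment> \<open>Enlarging the bound to \<open>S + e\<close> makes the hypothesis on the core,
    with gain \<open>e\<close>, the original inequality. The resulting \<open>\<eta>\<close> is
    discarded.\<close>
  obtain \<eta> where "0 < \<eta>" "\<And>x. m \<phi>1 x \<le> m \<phi>2 x + ((S + e) - \<eta>)"
    using m_gain[OF adm, of "S + e" e] le \<open>0 < e\<close> by (metis add.assoc add_diff_cancel_right' add_increasing2 less_imp_le)
  then show "m \<phi>1 x \<le> m \<phi>2 x + S + e" by (smt (verit))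
qed

end

section \<open>Comparison of two fixed points\<close>

lemma fixed_point_le:
  assumes "entropic_killing M F X f r lam1" and "soft_impulse l lam2 K Ll"
    and adm: "admissible \<psi>1" "admissible \<psi>2"
    and fixp: "\<And>x. ereal (\<psi>1 x) = calT M F X f r l lam1 lam2 \<psi>1 x"
      "\<And>x. ereal (\<psi>2 x) = calT M F X f r l lam1 lam2 \<psi>2 x"
  shows "\<psi>1 x \<le> \<psi>2 x"
proof -
  interpret T: entropic_killing M F X f r lam1 by fact
  interpret I: soft_impulse l lam2 K Ll by fact
  have calT: "calT M F X f r l lam1 lam2 \<phi> = T_op M F X f r lam1 (I.m \<phi>)" for \<phi>
    by (simp add: calT_def I.m_def[abs_def])
  note fp = fixp[unfolded calT, symmetric]
  note meas = adm[THEN I.m_measurable]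
  obtain d1 d2 where "\<And>z. - d1 \<le> \<psi>1 z" "\<And>z. - d2 \<le> \<psi>2 z"
    using adm[THEN admissibleE] by metis
  then have "K - d1 \<le> I.m \<psi>1 y" "K - d2 \<le> I.m \<psi>2 y" for y
    using adm by (auto intro: I.m_ge)
  \<comment> \<open>One lower bound for both images under \<open>m\<close>, as the estimates for
    \<open>T_op\<close> require.\<close>
  moreover define c where "c = max (d1 - K) (d2 - K)"
  ultimately have lower: "- c \<le> I.m \<psi>1 y" "- c \<le> I.m \<psi>2 y" for y
    by (smt (verit))+
  \<comment> \<open>Only nonnegative bounds pass through \<open>T_op\<close>, hence the
    \<open>max 0\<close> in both uses below.\<close>
  have step: "\<psi>1 x \<le> \<psi>2 x + s" if "\<And>y. I.m \<psi>1 y \<le> I.m \<psi>2 y + s" "0 \<le> s" for s x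
    using T.T_op_le_add[OF meas lower that, of x] by (simp add: fp)
  define S where "S = (SUP x. \<psi>1 x - \<psi>2 x)"
  obtain S0 where S0: "\<And>x. I.m \<psi>1 x \<le> I.m \<psi>2 x + S0" using adm by (rule I.m_diff_bounded) blast
  have "\<psi>1 x \<le> \<psi>2 x + max 0 S0" for x
  proof (rule step)
    show "I.m \<psi>1 y \<le> I.m \<psi>2 y + max 0 S0" for y using S0[of y] by linarith
  qed simp
  then have "bdd_above (range (\<lambda>x. \<psi>1 x - \<psi>2 x))"
    by (intro bdd_aboveI[of _ "max 0 S0"]) (auto simp: algebra_simps)
  then have le_S: "\<psi>1 x \<le> \<psi>2 x + S" for x
    unfolding S_def using cSUP_upper[of x UNIV "\<lambda>x. \<psi>1 x - \<psi>2 x"] by simp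
  have S_le: "S \<le> s" if "\<And>x. \<psi>1 x \<le> \<psi>2 x + s" for s
    unfolding S_def using that by (intro cSUP_least) (auto simp: algebra_simps)
  have "S \<le> 0"
  proof (rule ccontr)
    assume "\<not> S \<le> 0"
    then have S: "0 < S" by simp
    have "bounded (\<psi>2 ` {-1..1})"
      using adm(2) by (intro compact_imp_bounded compact_continuous_image)
        (auto simp: admissible_def intro: continuous_on_subset)
    \<comment> \<open>At a fixed point \<open>\<psi>2 z\<close> is the value of \<open>T_op\<close>,
      so \<open>C\<close> bounds that value on the core, as the contraction estimate
      requires.\<close>
    then obtain C where C: "\<And>z. z \<in> {-1..1} \<Longrightarrow> \<psi>2 z \<le> C"
      unfolding bounded_real by (metis abs_le_D1 image_eqI)
    obtain \<kappa> where \<kappa>: "\<kappa> < 1"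
      "\<And>phi1 s x v. \<lbrakk>phi1 \<in> borel_measurable borel; \<And>y. - c \<le> phi1 y; 0 \<le> s;
        \<And>y. phi1 y \<le> I.m \<psi>2 y + s; T_op M F X f r lam1 (I.m \<psi>2) x = ereal v; v \<le> C\<rbrakk>
      \<Longrightarrow> T_op M F X f r lam1 phi1 x \<le> ereal (v + \<kappa> * s)"
      using T.T_op_contract[OF meas(2) lower(2), of C] by blast
    have m_le_S: "I.m \<psi>1 y \<le> I.m \<psi>2 y + S" for y using adm le_S by (rule I.m_mono_add)
    \<comment> \<open>The contraction factor on the core, written as the gain
      \<open>\<delta> = (1 - \<kappa>) * S\<close> for \<open>m_gain\<close>.\<close>
    have "\<psi>1 z \<le> \<psi>2 z + S - (1 - \<kappa>) * S" if "z \<in> {-1..1}" for z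
    proof -
      have "T_op M F X f r lam1 (I.m \<psi>1) z \<le> ereal (\<psi>2 z + \<kappa> * S)"
        using S C[OF that] m_le_S by (intro \<kappa>(2) meas lower fp) auto
      then show ?thesis by (simp add: fp algebra_simps)
    qed
    moreover have "0 < (1 - \<kappa>) * S" using \<kappa> S by simp
    ultimately obtain \<eta> where \<eta>: "0 < \<eta>" "\<And>x. I.m \<psi>1 x \<le> I.m \<psi>2 x + (S - \<eta>)"
      using I.m_gain[OF adm le_S, of "(1 - \<kappa>) * S"] by blast
    have "\<psi>1 x \<le> \<psi>2 x + max 0 (S - \<eta>)" for x
    proof (rule step)
      show "I.m \<psi>1 y \<le> I.m \<psi>2 y + max 0 (S - \<eta>)" for y using \<eta>(2)[of y] by linarith
    qed simp
    \<comment> \<open>Minimality of \<open>S\<close> is violated by either value of the maximum, as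
      both \<open>S\<close> and \<open>\<eta>\<close> are positive.\<close>
    then have "S \<le> max 0 (S - \<eta>)" by (rule S_le)
    then show False using S \<eta>(1) by simp
  qed
  then show ?thesis using le_S[of x] by simp
qed

theorem theorem4p4:
  fixes M :: "'a measure" and F :: "real \<Rightarrow> 'a measure"
    and W :: "real \<Rightarrow> 'a \<Rightarrow> real" and X :: "real \<Rightarrow> real \<Rightarrow> 'a \<Rightarrow> real"
    and b sig f l :: "real \<Rightarrow> real"
    and L sig0 L_f L_l K r lam1 lam2 :: real
  assumes "prob_space M"
    and "usual_filtration M F"
    and "brownian_motion M F W"
    and "\<forall>x. sde_solution M F W b sig x (X x)"
    and "L > 0"
    and "\<forall>x y. \<bar>b x - b y\<bar> + \<bar>sig x - sig y\<bar> \<le> L * \<bar>x - y\<bar>"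
    and "sig0 > 0" and "\<forall>x. \<bar>sig x\<bar> \<ge> sig0"
    and "\<forall>x. f x \<ge> 0" and "f 0 = 0" and "L_f-lipschitz_on UNIV f"
    and "K > 0" and "\<forall>\<xi>. l \<xi> \<ge> K" and "l 0 = K"
    and "\<forall>x y. l x + l y \<ge> l (x + y) + K"
    and "filterlim l at_top at_infinity"
    and "L_l-lipschitz_on UNIV l"
    and "0 < r - (L + L\<^sup>2 / 2)" and "r - (L + L\<^sup>2 / 2) < L_f / L_l"
    and "lam1 > 0" and "lam2 > 0"
  shows "\<forall>\<psi>1 \<psi>2 :: real \<Rightarrow> real.
           ((\<exists>C. C-lipschitz_on UNIV \<psi>1) \<and> bdd_below (range \<psi>1) \<and>
              (\<forall>x. ereal (\<psi>1 x) = calT M F X f r l lam1 lam2 \<psi>1 x)) \<and>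
           ((\<exists>C. C-lipschitz_on UNIV \<psi>2) \<and> bdd_below (range \<psi>2) \<and>
              (\<forall>x. ereal (\<psi>2 x) = calT M F X f r l lam1 lam2 \<psi>2 x))
           \<longrightarrow> \<psi>1 = \<psi>2"
proof -
  have X: "adapted M F (X x)" "\<And>\<omega>. \<omega> \<in> space M \<Longrightarrow> continuous_on {0..} (\<lambda>t. X x t \<omega>)" for x
    using assms(4) by (auto simp: sde_solution_def)
  have "X x t \<in> borel_measurable M" if "0 \<le> t" for x t
  proof (rule measurable_from_subalg)
    show "subalgebra M (F t)" using assms(2) that by (simp add: usual_filtration_def)
    show "X x t \<in> borel_measurable (F t)" using X(1)[of x] that by (simp add: adapted_def)
  qed
  moreover have "f \<in> borel_measurable borel"
    using assms(11) by (intro borel_measurable_continuous_onI lipschitz_on_continuous_on)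
  \<comment> \<open>The discount exceeds \<open>L + L\<^sup>2 / 2\<close>, which is
    positive.\<close>
  moreover have "0 < r"
  proof -
    have "0 \<le> L\<^sup>2 / 2" by simp
    then show ?thesis using assms(5,18) by linarith
  qed
  ultimately have T: "entropic_killing M F X f r lam1"
    using assms(1,2,9,20) X(2) by (simp add: entropic_killing_def entropic_killing_axioms_def)
  have I: "soft_impulse l lam2 K L_l" using assms(13,17,21) by unfold_locales auto
  have adm: "admissible \<psi>" if "\<exists>C. C-lipschitz_on UNIV \<psi>" "bdd_below (range \<psi>)"
    for \<psi> :: "real \<Rightarrow> real"
    using that lipschitz_on_continuous_on by (auto simp: admissible_def)
  show ?thesis
  \<comment> \<open>Equality by antisymmetry: the comparison lemma is applied with the two fixed
    points in both orders.\<close>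
  proof (intro allI impI ext antisym, goal_cases)
    case (1 \<psi>1 \<psi>2 x)
    then show ?case by (intro fixed_point_le[OF T I] adm) simp_all
  next
    case (2 \<psi>1 \<psi>2 x)
    then show ?case by (intro fixed_point_le[OF T I] adm) simp_all
  qed
qed

end
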